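(* Let $(r_n: n \in \mathbb{N})$ and $(s_n: n \in \mathbb{N})$ be cutting and spacer parameters giving rise to the symbolic rank-one system $(X, \mu, \sigma)$. Let $(r_n: n \in \mathbb{N})$ and $(t_n: n \in \mathbb{N})$ be cutting and spacer parameters (with the same cutting parameter) giving rise to the symbolic rank-one system $(Y, \nu, \sigma)$. Suppose the following hold. (a) For all $n\in\mathbb{N}$, $\sum_{i=1}^{r_n-1} s_{n}(i) = \sum_{i=1}^{r_n-1} t_{n}(i)$. (b) There is an $S \in \mathbb{N}$ such that for all $n$ and all $1\leq i \leq r_n-1$, $s_n(i) \leq S$ and $t_n(i) \leq S$. (c) There is an $R \in \mathbb{N}$ such that for infinitely many $n$, $r_n \leq R$ and $s_n \perp t_n$. (d) For each integer $k >1$, either $(X, \mu, \sigma^k)$ or $(Y, \nu, \sigma^k)$ is ergodic. Then $(X, \mu, \sigma)$ and $(Y, \nu, \sigma)$ are disjoint.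
   Context: $\mathbb{N}=\{0,1,2,\dots\}$. Words: finite sequences of natural numbers are called words; $\mathrm{lh}(s)$ is the length of $s$, $s=(s(1),\dots,s(\mathrm{lh}(s)))$, and ${}^{\frown}$ is concatenation. A word $t$ is a subword of $s$ if it occurs in $s$ as a block of consecutive entries. For words $s,t$ of the same length, $s\perp t$ (incompatible) means that $t$ is not a subword of $s^{\frown}(c)^{\frown} s$ for any $c\in\mathbb{N}$. Parameters: a cutting parameter is a sequence $(r_n:n\in\mathbb{N})$ of natural numbers with $r_n\ge 2$; a spacer parameter is a sequence $(s_n:n\in\mathbb{N})$ of finite sequences of natural numbers with $\mathrm{lh}(s_n)=r_n-1$. They define finite binary words (the generating sequence) by $v_0=0$, $v_{n+1}=v_n1^{s_n(1)}v_n1^{s_n(2)}v_n\cdots v_n1^{s_n(r_n-1)}v_n$. Each $v_n$ is an initial segment of $v_{n+1}$; let $V=\lim_n v_n$ be the infinite binary word having all $v_n$ as initial segments (an infinite rank-one word). Let $X=X_V$ be the set of $x\in\{0,1\}^{\mathbb{Z}}$ all of whose finite subwords are subwords of $V$, and let $\sigma$ be the shift $\sigma(x)(i)=x(i+1)$ on $X$. Let $h_n=\mathrm{lh}(v_n)$. Standing assumptions: $\sum_{n}\frac{h_{n+1}-h_nr_n}{h_{n+1}}<+\infty$; and $V$ is non-degenerate, i.e. there is no finite binary word $v$ beginning and ending with $0$ and $a\in\mathbb{N}$ with $V=v1^{a}v1^{a}v\cdots$. (All infinite rank-one words considered satisfy these.) The measure $\mu$ is the unique $\sigma$-invariant Borel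 probability measure on $X$; $(X,\mu,\sigma)$ is the symbolic rank-one system given by the parameters. $(Y,\nu,\sigma)$ is obtained in the same way from its parameters. Two measure-preserving transformations $(X,\mu,T)$ and $(Y,\nu,S)$ are disjoint if $\mu\times\nu$ is the only measure on $X\times Y$ that is $T\times S$-invariant and has $\mu$ and $\nu$ as marginals. *)

theory Defs
  imports "HOL-Probability.Probability" "HOL-Library.Sublist"
begin

definition incompatible :: "nat list \<Rightarrow> nat list \<Rightarrow> bool" where
  "incompatible s t \<longleftrightarrow> length s = length t \<and> (\<forall>c. \<not> sublist t (s @ [c] @ s))"

text \<open>The entries \<open>s(1), \<dots>, s(lh(s))\<close> of a word are \<open>s ! 0, \<dots>, s ! (length s - 1)\<close>.\<close>

definition cutting_parameter :: "(nat \<Rightarrow> nat) \<Rightarrow> bool" where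
  "cutting_parameter r \<longleftrightarrow> (\<forall>n. 2 \<le> r n)"

definition spacer_parameter :: "(nat \<Rightarrow> nat) \<Rightarrow> (nat \<Rightarrow> nat list) \<Rightarrow> bool" where
  "spacer_parameter r s \<longleftrightarrow> (\<forall>n. length (s n) = r n - 1)"

text \<open>The generating sequence does not mention the cutting parameter, which is recovered
  from the spacer parameter as \<open>r n = length (s n) + 1\<close>.\<close>

primrec gen_word :: "(nat \<Rightarrow> nat list) \<Rightarrow> nat \<Rightarrow> nat list" where
  "gen_word s 0 = [0]"
| "gen_word s (Suc n) =
     gen_word s n @ concat (map (\<lambda>a. replicate a 1 @ gen_word s n) (s n))"

text \<open>Position \<open>i\<close> of the limit word can be read off from the \<open>i\<close>-th generating word, whose
  length is at least \<open>2 ^ i\<close>; the lemma \<open>gen_word_initial_segment\<close> below shows that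
  all generating words are initial segments of \<open>rank_one_word s\<close>.\<close>

definition rank_one_word :: "(nat \<Rightarrow> nat list) \<Rightarrow> nat \<Rightarrow> nat" where
  "rank_one_word s i = gen_word s i ! i"

lemma prefix_gen_word: "m \<le> n \<Longrightarrow> prefix (gen_word s m) (gen_word s n)"
  by (induction n rule: dec_induct) (auto intro: prefix_order.trans)

lemma length_gen_word:
  assumes "cutting_parameter r" "spacer_parameter r s"
  shows "2 ^ n \<le> length (gen_word s n)"
proof (induction n)
  case (Suc n)
  have "length (s n) \<ge> 1"
    using assms unfolding cutting_parameter_def spacer_parameter_def
    by (metis One_nat_def diff_le_mono diff_Suc_1 numeral_2_eq_2)
  then obtain a as where "s n = a # as"
    by (cases "s n") auto
  with Suc show ?case
    by simp
qed simp

lemma gen_word_initial_segment: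
  assumes "cutting_parameter r" "spacer_parameter r s"
  shows "gen_word s n = map (rank_one_word s) [0..<length (gen_word s n)]"
proof (rule nth_equalityI)
  fix i assume i: "i < length (gen_word s n)"
  have "i < length (gen_word s i)"
    using length_gen_word[OF assms, of i] less_exp[of i] by linarith
  with i have "gen_word s n ! i = gen_word s i ! i"
    using prefix_gen_word[of n i s] prefix_gen_word[of i n s]
    by (metis nle_le nth_append prefix_def)
  with i show "gen_word s n ! i = map (rank_one_word s) [0..<length (gen_word s n)] ! i"
    by (simp add: rank_one_word_def)
qed simp

definition subword_of_infinite :: "nat list \<Rightarrow> (nat \<Rightarrow> nat) \<Rightarrow> bool" where
  "subword_of_infinite u V \<longleftrightarrow> (\<exists>k. u = map (\<lambda>i. V (k + i)) [0..<length u])"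

definition subword_of_biinfinite :: "nat list \<Rightarrow> (int \<Rightarrow> nat) \<Rightarrow> bool" where
  "subword_of_biinfinite u x \<longleftrightarrow> (\<exists>k. u = map (\<lambda>i. x (k + int i)) [0..<length u])"

definition word_shift_space :: "(nat \<Rightarrow> nat) \<Rightarrow> (int \<Rightarrow> nat) set" where
  "word_shift_space V =
     {x. range x \<subseteq> {0, 1} \<and> (\<forall>u. subword_of_biinfinite u x \<longrightarrow> subword_of_infinite u V)}"

definition shift_map :: "(int \<Rightarrow> nat) \<Rightarrow> int \<Rightarrow> nat" where
  "shift_map x = (\<lambda>i. x (i + 1))"

definition degenerate_word :: "(nat \<Rightarrow> nat) \<Rightarrow> bool" where
  "degenerate_word V \<longleftrightarrow>
     (\<exists>v a. v \<noteq> [] \<and> set v \<subseteq> {0, 1} \<and> hd v = 0 \<and> last v = 0 \<and>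
       (\<forall>i. V i = (v @ replicate a 1) ! (i mod (length v + a))))"

definition preserves_measure :: "'a measure \<Rightarrow> ('a \<Rightarrow> 'a) \<Rightarrow> bool" where
  "preserves_measure M T \<longleftrightarrow> T \<in> measurable M M \<and> distr M M T = M"

definition ergodic :: "'a measure \<Rightarrow> ('a \<Rightarrow> 'a) \<Rightarrow> bool" where
  "ergodic M T \<longleftrightarrow> prob_space M \<and> preserves_measure M T \<and>
     (\<forall>A\<in>sets M. T -` A \<inter> space M = A \<longrightarrow> measure M A = 0 \<or> measure M A = 1)"

definition joinings ::
  "'a measure \<Rightarrow> ('a \<Rightarrow> 'a) \<Rightarrow> 'b measure \<Rightarrow> ('b \<Rightarrow> 'b) \<Rightarrow> ('a \<times> 'b) measure set" where
  "joinings M T N S = {L. sets L = sets (M \<Otimes>\<^sub>M N) \<and> preserves_measure L (map_prod T S) \<and>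
     distr L M fst = M \<and> distr L N snd = N}"

definition disjoint_systems ::
  "'a measure \<Rightarrow> ('a \<Rightarrow> 'a) \<Rightarrow> 'b measure \<Rightarrow> ('b \<Rightarrow> 'b) \<Rightarrow> bool" where
  "disjoint_systems M T N S \<longleftrightarrow> joinings M T N S = {M \<Otimes>\<^sub>M N}"

text \<open>The Borel structure on a shift space is that of the product topology on \<open>int \<Rightarrow> nat\<close>
  with \<open>nat\<close> discrete, which induces the usual topology on 0-1 sequences.\<close>

definition invariant_probabilities :: "(int \<Rightarrow> nat) set \<Rightarrow> (int \<Rightarrow> nat) measure set" where
  "invariant_probabilities X =
     {M. sets M = sets (restrict_space borel X) \<and> prob_space M \<and> preserves_measure M shift_map}"

text \<open>\<open>symbolic_rank_one_system r s M\<close> says that \<open>r\<close> and \<open>s\<close> are cutting and spacer parameters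
  satisfying the standing assumptions (finite measure, non-degeneracy) and that \<open>M\<close> is
  the unique shift-invariant Borel probability measure on the shift space they define,
  which is \<open>space M\<close>.\<close>

definition symbolic_rank_one_system ::
  "(nat \<Rightarrow> nat) \<Rightarrow> (nat \<Rightarrow> nat list) \<Rightarrow> (int \<Rightarrow> nat) measure \<Rightarrow> bool" where
  "symbolic_rank_one_system r s M \<longleftrightarrow>
     cutting_parameter r \<and> spacer_parameter r s \<and>
     summable (\<lambda>n. (real (length (gen_word s (Suc n))) - real (length (gen_word s n)) * real (r n))
                   / real (length (gen_word s (Suc n)))) \<and>
     \<not> degenerate_word (rank_one_word s) \<and>
     invariant_probabilities (word_shift_space (rank_one_word s)) = {M}"

end

theory Submission
  imports Defs
begin

text \<open>Let \<open>L\<close> be a joining and \<open>n\<close> a level with incompatible spacers. For every pair \<open>(x, y)\<close>, within a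
  bounded multiple of \<open>h = length (gen_word s n)\<close> there is a window of length about \<open>h/2\<close> on which
  \<open>x\<close> repeats after time \<open>h + \<alpha>\<close> and \<open>y\<close> after time \<open>h + \<beta>\<close>, where \<open>\<alpha> \<noteq> \<beta>\<close> are at most \<open>S\<close>. Averages
  along the orbit over such windows are asymptotically independent of the window, so up to a
  small error \<open>L\<close> cannot distinguish \<open>y\<close> from its shift by \<open>\<alpha> - \<beta>\<close>. Since all these differences
  divide \<open>K = (S + 2)!\<close>, the joining is invariant under \<open>id \<times> \<sigma>\<^sup>K\<close> and hence under \<open>\<sigma>\<^sup>K \<times> id\<close>. Ergodicity
  of \<open>\<sigma>\<^sup>K\<close> in one of the coordinates forces \<open>L\<close> to be the product measure.\<close>

subsection \<open>Spacers between copies of a generating word\<close>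

text \<open>The start of the window and the pair \<alpha>, \<beta> depend on the point, and nothing
  is known about how often each pair occurs. So no single difference is shown to leave
  \<open>L\<close> invariant; each point moves in steps of its own length between the same two
  relative shifts, which works for any common multiple of the possible differences. To integrate
  this pointwise comparison without choosing windows measurably, the errors at all possible
  positions are added. The sum stays small because positions are rounded to a grid of bounded size:
  a mismatch appears within r_n copies, so the bound on r_n places the windows within a fixed
  multiple of h while h grows. Equal spacer sums give both systems the same h at each level, so the
  two return times differ by spacers alone. Since \<open>L\<close> need not be ergodic, orbit
  averages need not approach constants; it is enough that averages over different windows are close
  in mean.\<close>

definition spaced :: "nat list \<Rightarrow> nat list \<Rightarrow> nat list" where
  "spaced u as = u @ concat (map (\<lambda>a. replicate a 1 @ u) as)"

definition interleave :: "nat list \<Rightarrow> nat list \<Rightarrow> nat list" where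
  "interleave as bs = as @ concat (map (\<lambda>b. b # as) bs)"

lemma spaced_append: "spaced u (as @ b # bs) = spaced u as @ replicate b 1 @ spaced u bs"
  by (simp add: spaced_def)

lemma spaced_spaced: "spaced (spaced u as) bs = spaced u (interleave as bs)"
proof (induction bs rule: rev_induct)
  case (snoc b bs)
  have "spaced (spaced u as) (bs @ [b]) = spaced (spaced u as) bs @ replicate b 1 @ spaced u as"
    by (simp add: spaced_def)
  also have "\<dots> = spaced u (interleave as bs @ b # as)"
    by (simp add: snoc.IH spaced_append)
  finally show ?case
    by (simp add: interleave_def)
qed (simp add: spaced_def interleave_def)

text \<open>The spacers between consecutive copies of the level \<open>n\<close> word inside the
  level \<open>n + m\<close> word. Passing to the next level repeats the whole list, with the new
  spacers as separators.\<close>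

primrec level_spacers :: "(nat \<Rightarrow> nat list) \<Rightarrow> nat \<Rightarrow> nat \<Rightarrow> nat list" where
  "level_spacers s n 0 = []"
| "level_spacers s n (Suc m) = interleave (level_spacers s n m) (s (n + m))"

lemma gen_word_level_spacers: "gen_word s (n + m) = spaced (gen_word s n) (level_spacers s n m)"
proof (induction m)
  case (Suc m)
  have "gen_word s (n + Suc m) = spaced (gen_word s (n + m)) (s (n + m))"
    by (simp add: spaced_def)
  then show ?case
    by (simp add: Suc.IH spaced_spaced)
qed (simp add: spaced_def)

lemma prefix_level_spacers:
  "m \<le> m' \<Longrightarrow> prefix (level_spacers s n m) (level_spacers s n m')"
  by (induction m' rule: dec_induct) (auto intro: prefix_order.trans simp: interleave_def)

lemma length_level_spacers:
  assumes "cutting_parameter r" "spacer_parameter r s"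
  shows "m \<le> length (level_spacers s n m)"
proof (induction m)
  case (Suc m)
  have "length (s (n + m)) \<ge> 1"
    using assms unfolding cutting_parameter_def spacer_parameter_def
    by (metis One_nat_def diff_le_mono diff_Suc_1 numeral_2_eq_2)
  then obtain a as where "s (n + m) = a # as"
    by (cases "s (n + m)") auto
  with Suc show ?case
    by (simp add: interleave_def)
qed simp

text \<open>The shape u c u c' ... u with free separators, expressed by residues. There is one
  spacer fewer than there are copies, hence \<open>Suc (length as)\<close>; its divisibility keeps
  the pattern in phase when two lists are joined by a further separator.\<close>

definition periodic_spacers :: "nat \<Rightarrow> nat list \<Rightarrow> nat list \<Rightarrow> bool" where
  "periodic_spacers S u as \<longleftrightarrow> Suc (length u) dvd Suc (length as) \<and> (\<forall>a\<in>set as. a \<le> S) \<and>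
     (\<forall>i<length as. i mod Suc (length u) < length u \<longrightarrow> as ! i = u ! (i mod Suc (length u)))"

lemma periodic_spacers_append:
  assumes "periodic_spacers S u as" "periodic_spacers S u bs" "b \<le> S"
  shows "periodic_spacers S u (as @ b # bs)"
  unfolding periodic_spacers_def
proof (intro conjI allI impI)
  let ?r = "Suc (length u)"
  have dvd: "?r dvd Suc (length as)" "?r dvd Suc (length bs)"
    using assms by (auto simp: periodic_spacers_def)
  then have "?r dvd Suc (length as) + Suc (length bs)"
    by (rule dvd_add)
  then show "?r dvd Suc (length (as @ b # bs))"
    by simp
  show "\<forall>a\<in>set (as @ b # bs). a \<le> S"
    using assms by (auto simp: periodic_spacers_def)
  fix i assume i: "i < length (as @ b # bs)" "i mod ?r < length u"
  consider "i < length as" | "i = length as" | "length as < i"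
    by linarith
  then show "(as @ b # bs) ! i = u ! (i mod ?r)"
  proof cases
    case 1
    with i(2) assms(1) show ?thesis
      by (simp add: periodic_spacers_def nth_append)
  next
    case 2
    obtain q where "Suc i = ?r * q"
      using dvd(1) 2 by (auto elim: dvdE)
    then have "i = length u + ?r * (q - 1)"
      by (cases q) auto
    then have "i mod ?r = length u"
      by (metis lessI mod_less mod_mult_self2)
    with i(2) show ?thesis by simp
  next
    case 3
    define j where "j = i - Suc (length as)"
    have ij: "i = Suc (length as) + j" and j: "j < length bs"
      using 3 i(1) by (simp_all add: j_def)
    obtain q where "Suc (length as) = ?r * q"
      using dvd(1) by (auto elim: dvdE)
    then have "i = j + ?r * q"
      by (simp add: ij)
    then have "i mod ?r = j mod ?r"
      by (simp only: mod_mult_self2)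
    moreover have "(as @ b # bs) ! i = bs ! j"
      by (simp add: ij nth_append)
    ultimately show ?thesis
      using j i(2) assms(2) by (auto simp: periodic_spacers_def)
  qed
qed

lemma periodic_spacers_interleave:
  assumes "periodic_spacers S u as" "\<forall>b\<in>set bs. b \<le> S"
  shows "periodic_spacers S u (interleave as bs)"
  using assms(2)
proof (induction bs rule: rev_induct)
  case (snoc b bs)
  have "interleave as (bs @ [b]) = interleave as bs @ b # as"
    by (simp add: interleave_def)
  with snoc assms(1) show ?case
    by (simp add: periodic_spacers_append)
qed (use assms(1) in \<open>simp add: interleave_def\<close>)

text \<open>The induction starts one level above \<open>n\<close>: at level \<open>n\<close> itself
  the list is empty, which fails the divisibility unless \<open>s n\<close> is empty.\<close>

lemma periodic_level_spacers:
  assumes "\<And>m. \<forall>a\<in>set (s m). a \<le> S"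
  shows "periodic_spacers S (s n) (level_spacers s n (Suc m))"
proof (induction m)
  case 0
  have "level_spacers s n (Suc 0) = s n"
    by (simp add: interleave_def)
  then show ?case
    using assms by (simp add: periodic_spacers_def)
next
  case (Suc m)
  then show ?case
    using periodic_spacers_interleave[OF Suc assms] by (subst level_spacers.simps(2))
qed

lemma length_spaced: "length (spaced u as) = (\<Sum>i<length as. length u + as ! i) + length u"
proof (induction as rule: rev_induct)
  case (snoc a as)
  have "(\<Sum>i<length as. length u + (as @ [a]) ! i) = (\<Sum>i<length as. length u + as ! i)"
    by (intro sum.cong) (auto simp: nth_append)
  with snoc show ?case
    by (simp add: spaced_def)
qed (simp add: spaced_def)

text \<open>The sum is the starting position of copy number \<open>i\<close>, counted from 0.
  Cutting \<open>as\<close> after \<open>i\<close> entries makes this copy the last one of a shorter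
  word.\<close>

lemma nth_spaced:
  assumes "i \<le> length as" "j < length u"
  shows "(\<Sum>i'<i. length u + as ! i') + j < length (spaced u as)"
    and "spaced u as ! ((\<Sum>i'<i. length u + as ! i') + j) = u ! j"
proof -
  define ps qs where "ps = take i as" and "qs = drop i as"
  have as: "as = ps @ qs" and len: "length ps = i"
    using assms(1) by (simp_all add: ps_def qs_def)
  have P: "(\<Sum>i'<i. length u + as ! i') = (\<Sum>i'<i. length u + ps ! i')"
    using assms(1) by (intro sum.cong) (auto simp: ps_def)
  obtain w where w: "spaced u as = spaced u ps @ w"
    by (simp add: as spaced_def)
  obtain v where v: "spaced u ps = v @ u" and lv: "length v = (\<Sum>i'<i. length u + ps ! i')"
  proof (cases ps rule: rev_cases)
    case Nil
    with that[of "[]"] len show ?thesis by (simp add: spaced_def)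
  next
    case (snoc qs q)
    then obtain v where "spaced u ps = v @ u"
      by (simp add: spaced_def)
    moreover from this have "length v = (\<Sum>i'<i. length u + ps ! i')"
      using length_spaced[of u ps] len by simp
    ultimately show ?thesis by (rule that)
  qed
  show "(\<Sum>i'<i. length u + as ! i') + j < length (spaced u as)"
    using w v lv P assms(2) by simp
  show "spaced u as ! ((\<Sum>i'<i. length u + as ! i') + j) = u ! j"
    using w v lv P assms(2) by (simp add: nth_append)
qed

text \<open>The lists of successive levels extend each other, so reading entry \<open>i\<close> from
  a level where it already exists yields one infinite spacer sequence. Only letters inside copies
  are described, since the windows used later never leave a copy.\<close>

lemma rank_one_word_spacers:
  assumes "cutting_parameter r" "spacer_parameter r s" "\<And>n i. i < r n - 1 \<Longrightarrow> s n ! i \<le> S"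
  obtains a where "\<And>i. a i \<le> S"
    "\<And>i. i mod r n < r n - 1 \<Longrightarrow> a i = s n ! (i mod r n)"
    "\<And>i j. j < length (gen_word s n) \<Longrightarrow>
       rank_one_word s ((\<Sum>i'<i. length (gen_word s n) + a i') + j) = gen_word s n ! j"
proof -
  define a where "a i = level_spacers s n (Suc i) ! i" for i
  have len: "length (s m) = r m - 1" for m
    using assms(2) by (simp add: spacer_parameter_def)
  have "2 \<le> r n"
    using assms(1) by (simp add: cutting_parameter_def)
  then have r: "Suc (r n - 1) = r n"
    by simp
  have bound: "\<forall>a\<in>set (s m). a \<le> S" for m
    using assms(3)[of _ m] len[of m] by (metis in_set_conv_nth)
  have long: "i < length (level_spacers s n (Suc i))" for i
    using length_level_spacers[OF assms(1,2), of "Suc i" n] by linarith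
  have a_eq: "level_spacers s n m ! i = a i" if "i < m" for i m
    using prefix_level_spacers[of "Suc i" m s n] long[of i] that
    unfolding a_def prefix_def by (metis Suc_leI nth_append)
  show ?thesis
  proof (rule that)
    fix i
    have per: "periodic_spacers S (s n) (level_spacers s n (Suc i))"
      by (rule periodic_level_spacers) (rule bound)
    then show "a i \<le> S"
      using nth_mem[OF long[of i]] unfolding periodic_spacers_def a_def by (elim conjE bspec)
    have "\<forall>j<length (level_spacers s n (Suc i)). j mod r n < r n - 1 \<longrightarrow>
        level_spacers s n (Suc i) ! j = s n ! (j mod r n)"
      using per unfolding periodic_spacers_def len r by (elim conjE)
    from this[rule_format, OF long] show "i mod r n < r n - 1 \<Longrightarrow> a i = s n ! (i mod r n)"
      unfolding a_def .
  next
    fix i j assume j: "j < length (gen_word s n)"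
    let ?P = "\<lambda>i. (\<Sum>i'<i. length (gen_word s n) + a i')"
    let ?L = "level_spacers s n i"
    have P: "?P i = (\<Sum>i'<i. length (gen_word s n) + ?L ! i')"
      by (intro sum.cong) (auto simp: a_eq)
    have le: "i \<le> length ?L"
      by (rule length_level_spacers[OF assms(1,2)])
    have pos: "?P i + j < length (gen_word s (n + i))"
      and nth: "gen_word s (n + i) ! (?P i + j) = gen_word s n ! j"
      using nth_spaced[OF le j] unfolding P gen_word_level_spacers by auto
    have "gen_word s (n + i) ! (?P i + j) =
        map (rank_one_word s) [0..<length (gen_word s (n + i))] ! (?P i + j)"
      using gen_word_initial_segment[OF assms(1,2), of "n + i"] by (rule arg_cong)
    also have "\<dots> = rank_one_word s (?P i + j)"
      using pos by simp
    finally show "rank_one_word s (?P i + j) = gen_word s n ! j"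
      using nth by simp
  qed
qed

text \<open>The length of the next word involves the spacers only through their sum. This is where
  the two systems obtain a common \<open>h\<close>.\<close>

lemma length_gen_word_eq:
  assumes "spacer_parameter r s" "spacer_parameter r t"
    and "\<And>n. (\<Sum>i<r n - 1. s n ! i) = (\<Sum>i<r n - 1. t n ! i)"
  shows "length (gen_word s n) = length (gen_word t n)"
proof (induction n)
  case (Suc n)
  have len: "length (s n) = r n - 1" "length (t n) = r n - 1"
    using assms(1,2) by (simp_all add: spacer_parameter_def)
  have "length (gen_word s (Suc n)) = (\<Sum>i<length (s n). length (gen_word s n) + s n ! i) + length (gen_word s n)"
    using length_spaced[of "gen_word s n" "s n"] by (simp add: spaced_def)
  moreover have "length (gen_word t (Suc n)) = (\<Sum>i<length (t n). length (gen_word t n) + t n ! i) + length (gen_word t n)"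
    using length_spaced[of "gen_word t n" "t n"] by (simp add: spaced_def)
  ultimately show ?case
    by (simp only: len sum.distrib Suc.IH assms(3))
qed simp

text \<open>Any \<open>r - 1\<close> consecutive entries of a sequence of the form \<open>s c s c' s \<dots>\<close> meet at most one of
  the separating letters, so they form a subword of some \<open>s c s\<close>.\<close>

lemma spacer_mismatch:
  fixes a b :: "nat \<Rightarrow> nat"
  assumes "incompatible s t" "0 < r" "length s = r - 1"
    and a: "\<And>i. i mod r < r - 1 \<Longrightarrow> a i = s ! (i mod r)"
    and b: "\<And>i. i mod r < r - 1 \<Longrightarrow> b i = t ! (i mod r)"
  shows "\<exists>i<r - 1. a (p + i) \<noteq> b (r * q + i)"
proof (rule ccontr)
  assume "\<not> ?thesis"
  then have eq: "a (p + i) = t ! i" if "i < r - 1" for i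
    using that b[of "r * q + i"] by auto
  have lt: "length t = r - 1"
    using assms(1,3) by (simp add: incompatible_def)
  define m where "m = p mod r"
  have m: "m < r"
    using assms(2) by (simp add: m_def)
  \<comment> \<open>The first index from \<open>p\<close> on with residue \<open>r - 1\<close>,
    where \<open>s\<close> prescribes nothing. For \<open>m = 0\<close> it lies just past the
    entries in question and \<open>c\<close> is arbitrary.\<close>
  define c where "c = a (p + (r - 1 - m))"
  let ?w = "s @ [c] @ s"
  have "t = take (r - 1) (drop m ?w)"
  proof (rule nth_equalityI)
    show "length t = length (take (r - 1) (drop m ?w))"
      using m lt assms(3) by simp
    fix i assume "i < length t"
    then have i: "i < r - 1" by (simp add: lt)
    have pi: "(p + i) mod r = (m + i) mod r"
      by (simp add: m_def mod_simps)
    have "take (r - 1) (drop m ?w) ! i = ?w ! (m + i)"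
      using i m assms(3) nth_drop[of m ?w i] by (simp only: nth_take) simp
    also have "\<dots> = a (p + i)"
    proof -
      consider "m + i < r - 1" | "m + i = r - 1" | "r \<le> m + i" by linarith
      then show ?thesis
      proof cases
        case 1
        then show ?thesis
          using a[of "p + i"] pi assms(3) by (simp add: nth_append)
      next
        case 2
        then have "i = r - 1 - m" by simp
        with 2 show ?thesis
          using assms(3) by (simp add: c_def nth_append)
      next
        case 3
        have "(m + i) mod r = m + i - r"
          using 3 m i by (subst le_mod_geq) (auto intro!: mod_less)
        then show ?thesis
          using 3 a[of "p + i"] pi i m assms(3) by (auto simp: nth_append)
      qed
    qed
    also have "\<dots> = t ! i"
      using eq i by simp
    finally show "t ! i = take (r - 1) (drop m ?w) ! i" ..
  qed
  then have "sublist t ?w"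
    by (metis append_take_drop_id sublist_def)
  with assms(1) show False
    by (simp add: incompatible_def)
qed

subsection \<open>Windows with distinct return times\<close>

lemma sum_lessThan_add:
  fixes f :: "nat \<Rightarrow> 'a::comm_monoid_add"
  shows "(\<Sum>i<m + n. f i) = (\<Sum>i<m. f i) + (\<Sum>i<n. f (m + i))"
  by (induction n) (simp_all add: add.assoc)

text \<open>The first term reaching \<open>x\<close> exists because of \<open>i \<le> f i\<close>,
  and its predecessor is below \<open>x\<close>. In use, \<open>f\<close> lists the starts of
  copies, or of every r-th copy.\<close>

lemma ex_grid_point:
  fixes f :: "nat \<Rightarrow> nat"
  assumes "f 0 = 0" "\<And>i. f (Suc i) \<le> f i + H" "\<And>i. i \<le> f i" "0 < H"
  shows "\<exists>i. x \<le> f i \<and> f i < x + H"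
proof -
  define i where "i = (LEAST i. x \<le> f i)"
  have x: "x \<le> f i"
    unfolding i_def using assms(3)[of x] by (rule LeastI)
  have "f i < x + H"
  proof (cases i)
    case 0
    with assms show ?thesis by simp
  next
    case (Suc j)
    then have "\<not> x \<le> f j"
      using not_less_Least[of j "\<lambda>i. x \<le> f i"] unfolding i_def by simp
    with Suc assms(2)[of j] show ?thesis by simp
  qed
  with x show ?thesis by blast
qed

text \<open>A copy of \<open>u\<close> in \<open>V\<close> and one of \<open>w\<close> in \<open>W\<close> that start at nearly the same time drift apart only
  through spacers. The first gap where the spacers differ sends the overlap of the two copies to
  two copies with different return times \<open>h + \<alpha>\<close> and \<open>h + \<beta>\<close>.\<close>

lemma ex_window_with_distinct_return_times:
  fixes V W u w a b :: "nat \<Rightarrow> nat" and h r S k l :: nat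
  defines "P \<equiv> \<lambda>i. \<Sum>i'<i. h + a i'" and "Q \<equiv> \<lambda>i. \<Sum>i'<i. h + b i'"
  assumes "0 < h" "0 < r"
    and a: "\<And>i. a i \<le> S" and b: "\<And>i. b i \<le> S"
    and V: "\<And>i j. j < h \<Longrightarrow> V (P i + j) = u j"
    and W: "\<And>i j. j < h \<Longrightarrow> W (Q i + j) = w j"
    and mismatch: "\<And>p q. \<exists>i<r. a (p + i) \<noteq> b (r * q + i)"
  shows "\<exists>st \<alpha> \<beta>. \<alpha> \<le> S \<and> \<beta> \<le> S \<and> \<alpha> \<noteq> \<beta> \<and> st \<le> (2 * r + 2) * (h + S) \<and>
    (\<forall>\<tau>. st \<le> \<tau> \<longrightarrow> \<tau> + S < st + h div 2 \<longrightarrow>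
       V (k + \<tau>) = V (k + \<tau> + h + \<alpha>) \<and> W (l + \<tau>) = W (l + \<tau> + h + \<beta>))"
proof -
  define H where "H = h + S"
  have steps: "(\<Sum>i'<n. h + c i') \<le> n * H" if "\<And>i. c i \<le> S" for c and n :: nat
    using sum_mono[of "{..<n}" "\<lambda>i. h + c i" "\<lambda>_. H"] that by (simp add: H_def)
  have add: "(\<Sum>i'<m + n. h + c i') = (\<Sum>i'<m. h + c i') + (\<Sum>i'<n. h + c (m + i'))" for c and m n :: nat
    by (rule sum_lessThan_add)
  have ge: "n \<le> (\<Sum>i'<n. h + c i')" for c n
    using sum_mono[of "{..<n}" "\<lambda>_. 1" "\<lambda>i. h + c i"] \<open>0 < h\<close> by simp
  \<comment> \<open>\<open>mismatch\<close> counts gaps in \<open>W\<close> from a multiple of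
    \<open>r\<close>, so only every r-th copy is searched. Starting at \<open>l + H\<close> leaves
    room to subtract \<open>h div 2\<close> below without truncation.\<close>
  have "\<exists>q. l + H \<le> Q (r * q) \<and> Q (r * q) < l + H + r * H"
  proof (rule ex_grid_point)
    fix q
    have "Q (r * Suc q) = Q (r * q) + (\<Sum>i'<r. h + b (r * q + i'))"
      unfolding Q_def using add[of b "r * q" r] by (simp add: add.commute)
    then show "Q (r * Suc q) \<le> Q (r * q) + r * H"
      using steps[of "\<lambda>i'. b (r * q + i')" r] b by simp
    have "q \<le> r * q"
      using \<open>0 < r\<close> by simp
    with ge[where n = "r * q" and c = b] show "q \<le> Q (r * q)"
      unfolding Q_def by linarith
  qed (use \<open>0 < h\<close> \<open>0 < r\<close> in \<open>simp_all add: Q_def H_def\<close>)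
  then obtain q where q: "l + H \<le> Q (r * q)" "Q (r * q) < l + H + r * H"
    by blast
  define y where "y = Q (r * q) - l"
  have y: "H \<le> y" "y < H + r * H" "Q (r * q) = l + y"
    using q by (simp_all add: y_def)
  \<comment> \<open>Aiming \<open>h div 2\<close> early balances the two cases: whichever copy
    starts first, they overlap in at least \<open>h div 2 - S\<close> places. This is the source of
    \<open>\<tau> + S < st + h div 2\<close>.\<close>
  have "\<exists>p. k + y - h div 2 \<le> P p \<and> P p < k + y - h div 2 + H"
    by (rule ex_grid_point) (use \<open>0 < h\<close> a ge in \<open>simp_all add: P_def H_def\<close>)
  then obtain p where p: "k + y - h div 2 \<le> P p" "P p < k + y - h div 2 + H"
    by blast
  have H: "h div 2 \<le> H"
    by (simp add: H_def)
  define x where "x = P p - k"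
  have x: "P p = k + x" "y \<le> x + h div 2" "x + h div 2 < y + H"
    using p y(1) H by (simp_all add: x_def)
  define i where "i = (LEAST i. a (p + i) \<noteq> b (r * q + i))"
  obtain i0 where i0: "i0 < r" "a (p + i0) \<noteq> b (r * q + i0)"
    using mismatch by blast
  have ne: "a (p + i) \<noteq> b (r * q + i)"
    unfolding i_def using i0(2) by (rule LeastI)
  have "i \<le> i0"
    unfolding i_def using i0(2) by (rule Least_le)
  then have ir: "i < r"
    using i0(1) by simp
  have eq: "a (p + j) = b (r * q + j)" if "j < i" for j
    using not_less_Least[OF that[unfolded i_def]] by simp
  \<comment> \<open>Before the first mismatch both sides cover the same distance, so copies
    \<open>p + i\<close> and \<open>r * q + i\<close> have the same relative offset as the initial
    pair.\<close>
  define D where "D = (\<Sum>i'<i. h + a (p + i'))"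
  have D: "D \<le> r * H"
    using steps[of "\<lambda>j. a (p + j)" i] a ir unfolding D_def
    by (meson le_trans less_imp_le mult_le_mono1)
  have D_eq: "D = (\<Sum>i'<i. h + b (r * q + i'))"
    unfolding D_def by (intro sum.cong) (auto simp: eq)
  have Pi: "P (p + i) = k + (x + D)" and Qi: "Q (r * q + i) = l + (y + D)"
    using add[of a p i] add[of b "r * q" i] x(1) y(3) D_eq by (simp_all add: P_def Q_def D_def)
  have PS: "P (Suc (p + i)) = P (p + i) + (h + a (p + i))"
    and QS: "Q (Suc (r * q + i)) = Q (r * q + i) + (h + b (r * q + i))"
    by (simp_all add: P_def Q_def)
  define st where "st = max (x + D) (y + D)"
  have st: "st \<le> (2 * r + 2) * H"
    using x y D H by (simp add: st_def algebra_simps)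
  have "V (k + \<tau>) = V (k + \<tau> + h + a (p + i)) \<and> W (l + \<tau>) = W (l + \<tau> + h + b (r * q + i))"
    if \<tau>: "st \<le> \<tau>" "\<tau> + S < st + h div 2" for \<tau>
  proof -
    obtain j where j: "\<tau> = x + D + j"
      using \<tau>(1) by (metis le_Suc_ex max.bounded_iff st_def)
    obtain j' where j': "\<tau> = y + D + j'"
      using \<tau>(1) by (metis le_Suc_ex max.bounded_iff st_def)
    have jh: "j < h" and jh': "j' < h"
      using \<tau> x j j' unfolding st_def H_def by linarith+
    have "k + \<tau> = P (p + i) + j" "k + \<tau> + h + a (p + i) = P (Suc (p + i)) + j"
      using j Pi PS by simp_all
    moreover have "l + \<tau> = Q (r * q + i) + j'" "l + \<tau> + h + b (r * q + i) = Q (Suc (r * q + i)) + j'"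
      using j' Qi QS by simp_all
    ultimately show ?thesis
      by (simp only: V[OF jh] W[OF jh'])
  qed
  then show ?thesis
    using ne a b st unfolding H_def by blast
qed

subsection \<open>Averages along orbits\<close>

lemma preserves_measure_measurable: "preserves_measure M T \<Longrightarrow> T \<in> measurable M M"
  by (simp add: preserves_measure_def)

lemma preserves_measure_funpow:
  assumes "preserves_measure M T"
  shows "preserves_measure M (T ^^ n)"
proof (induction n)
  case 0
  show ?case
    by (simp add: preserves_measure_def distr_id2 id_def)
next
  case (Suc n)
  have "distr M M (T \<circ> T ^^ n) = distr (distr M M (T ^^ n)) M T"
    using Suc assms by (intro distr_distr[symmetric]) (auto simp: preserves_measure_def)
  also have "\<dots> = M"
    using Suc assms by (simp add: preserves_measure_def)
  finally show ?case
    using Suc assms by (auto simp: preserves_measure_def comp_def intro: measurable_compose)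
qed

lemma emeasure_preserves_measure:
  assumes "preserves_measure M T" "A \<in> sets M"
  shows "emeasure M (T -` A \<inter> space M) = emeasure M A"
  using assms emeasure_distr[of T M M A] by (simp add: preserves_measure_def)

lemma integral_preserves_measure:
  fixes f :: "'a \<Rightarrow> real"
  assumes "preserves_measure M T" "f \<in> borel_measurable M"
  shows "(\<integral>x. f (T x) \<partial>M) = (\<integral>x. f x \<partial>M)"
  using assms integral_distr[of T M M f] by (simp add: preserves_measure_def)

text \<open>The times \<open>l i\<close> are arbitrary and may repeat, so these averages are closed
  under midpoints. The least-norm argument below rests on this convexity.\<close>

definition orbit_avg :: "('a \<Rightarrow> 'a) \<Rightarrow> ('a \<Rightarrow> real) \<Rightarrow> nat \<Rightarrow> (nat \<Rightarrow> nat) \<Rightarrow> 'a \<Rightarrow> real" where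
  "orbit_avg T F m l z = (\<Sum>i<m. F ((T ^^ l i) z)) / real m"

lemma orbit_avg_midpoint:
  "orbit_avg T F m l z + orbit_avg T F m l' z =
    2 * orbit_avg T F (m + m) (\<lambda>i. if i < m then l i else l' (i - m)) z"
  by (simp add: orbit_avg_def sum_lessThan_add add_divide_distrib)

lemma abs_orbit_avg_le:
  assumes "\<And>z. \<bar>F z\<bar> \<le> 1"
  shows "\<bar>orbit_avg T F m l z\<bar> \<le> 1"
proof -
  have "\<bar>\<Sum>i<m. F ((T ^^ l i) z)\<bar> \<le> (\<Sum>i<m. 1)"
    using assms by (intro order.trans[OF sum_abs] sum_mono)
  then show ?thesis
    by (cases "m = 0") (simp_all add: orbit_avg_def)
qed

lemma borel_measurable_orbit_avg:
  assumes "T \<in> measurable M M" "F \<in> borel_measurable M"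
  shows "orbit_avg T F m l \<in> borel_measurable M"
proof -
  have "T ^^ n \<in> measurable M M" for n
    using assms(1) by (induction n) (auto intro: measurable_comp)
  then have "(\<lambda>z. F ((T ^^ l i) z)) \<in> borel_measurable M" for i
    using assms(2) by (rule measurable_compose)
  then show ?thesis
    unfolding orbit_avg_def by (intro borel_measurable_divide borel_measurable_sum) auto
qed

lemma orbit_avg_shift: "orbit_avg T F m ((+) n) z = orbit_avg T F m (\<lambda>i. i) ((T ^^ n) z)"
  by (simp add: orbit_avg_def add.commute[of n] funpow_add)

text \<open>Shifting a window by \<open>n\<close> loses at most \<open>n\<close> terms at one end
  and gains at most \<open>n\<close> at the other.\<close>

lemma orbit_avg_window_diff:
  assumes "\<And>z. \<bar>F z\<bar> \<le> 1"
  shows "\<bar>orbit_avg T F m ((+) n) z - orbit_avg T F m (\<lambda>i. i) z\<bar> \<le> 2 * real n / real m"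
proof -
  let ?f = "\<lambda>i. F ((T ^^ i) z)"
  have bound: "\<bar>\<Sum>i<n. ?f (k i)\<bar> \<le> real n" for k
    using order.trans[OF sum_abs sum_mono[of "{..<n}" "\<lambda>i. \<bar>?f (k i)\<bar>" "\<lambda>_. 1"]] assms by simp
  have "(\<Sum>i<n + m. ?f i) = (\<Sum>i<m + n. ?f i)"
    by (simp add: add.commute)
  then have "(\<Sum>i<m. ?f (n + i)) - (\<Sum>i<m. ?f i) = (\<Sum>i<n. ?f (m + i)) - (\<Sum>i<n. ?f i)"
    by (simp add: sum_lessThan_add)
  then have "\<bar>(\<Sum>i<m. ?f (n + i)) - (\<Sum>i<m. ?f i)\<bar> \<le> 2 * real n"
    using bound[of "\<lambda>i. m + i"] bound[of "\<lambda>i. i"] by linarith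
  then have "\<bar>(\<Sum>i<m. ?f (n + i)) - (\<Sum>i<m. ?f i)\<bar> / real m \<le> 2 * real n / real m"
    by (rule divide_right_mono) simp
  then show ?thesis
    by (simp add: orbit_avg_def diff_divide_distrib[symmetric])
qed

lemma power2_mean_le:
  fixes f :: "nat \<Rightarrow> real"
  shows "((\<Sum>i<m. f i) / real m)\<^sup>2 \<le> (\<Sum>i<m. (f i)\<^sup>2) / real m"
proof (cases "m = 0")
  case False
  have "(\<Sum>i<m. 1 * f i)\<^sup>2 \<le> (\<Sum>i<m. 1\<^sup>2) * (\<Sum>i<m. (f i)\<^sup>2)"
    by (rule Cauchy_Schwarz_ineq_sum)
  with False show ?thesis
    by (simp add: power_divide divide_simps power2_eq_square mult.commute mult.left_commute)
qed simp

text \<open>A substitute for the ergodic theorem, which also covers joinings that are not ergodic. All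
  averages over long windows nearly attain the least \<open>L\<^sup>2\<close> norm \<open>c\<close> among averages along the orbit, and
  so does the midpoint of two of them; the parallelogram law then makes the two close.\<close>

lemma orbit_avg_windows_close:
  assumes "prob_space M" and T: "preserves_measure M T" and F: "F \<in> borel_measurable M"
    and F1: "\<And>z. \<bar>F z\<bar> \<le> 1" and "0 < \<epsilon>"
  shows "\<exists>N0. \<forall>N\<ge>N0. \<forall>n.
    (\<integral>z. \<bar>orbit_avg T F N ((+) n) z - orbit_avg T F N (\<lambda>i. i) z\<bar> \<partial>M) \<le> \<epsilon>"
proof -
  interpret prob_space M by fact
  note meas = borel_measurable_orbit_avg[OF preserves_measure_measurable[OF T] F]
  note [measurable] = meas F preserves_measure_measurable[OF preserves_measure_funpow[OF T]]
  have integrable_bounded: "integrable M f" if "f \<in> borel_measurable M" "\<And>z. \<bar>f z\<bar> \<le> C" for f :: "'a \<Rightarrow> real" and C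
    using that by (intro integrable_const_bound[of _ C]) auto
  have sq1: "a\<^sup>2 \<le> 1" if "\<bar>a\<bar> \<le> 1" for a :: real
    using that by (simp add: abs_square_le_1)
  have int_sq: "integrable M (\<lambda>z. (orbit_avg T F m l z)\<^sup>2)" for m l
    by (rule integrable_bounded[of _ 1]) (auto intro!: sq1 abs_orbit_avg_le[of F, OF F1])
  have int_prod: "integrable M (\<lambda>z. orbit_avg T F m l z * orbit_avg T F m' l' z)" for m l m' l'
    by (rule integrable_bounded[of _ 1])
       (auto simp: abs_mult intro!: mult_le_one abs_orbit_avg_le[of F, OF F1])
  define \<phi> where "\<phi> = (\<lambda>(m, l). \<integral>z. (orbit_avg T F m l z)\<^sup>2 \<partial>M)"
  \<comment> \<open>The case \<open>m = 0\<close> is left out because the empty average is 0 and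
    would make the infimum 0.\<close>
  define c where "c = Inf (\<phi> ` {(m, l). 0 < m})"
  have bdd: "bdd_below (\<phi> ` {(m, l). 0 < m})"
    by (intro bdd_belowI[of _ 0]) (auto simp: \<phi>_def)
  have c_le: "c \<le> (\<integral>z. (orbit_avg T F m l z)\<^sup>2 \<partial>M)" if "0 < m" for m l
  proof -
    have "c \<le> \<phi> (m, l)"
      unfolding c_def using that by (intro cInf_lower bdd) simp
    then show ?thesis
      by (simp add: \<phi>_def)
  qed
  \<comment> \<open>Chosen so that the parallelogram law yields 4 * (c + 2 * \<delta>) - 4 * c =
    \<epsilon> squared.\<close>
  define \<delta> where "\<delta> = \<epsilon>\<^sup>2 / 8"
  have "0 < \<delta>"
    using \<open>0 < \<epsilon>\<close> by (simp add: \<delta>_def)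
  then have "Inf (\<phi> ` {(m, l). 0 < m}) < c + \<delta>"
    by (simp add: c_def)
  moreover have "(1, \<lambda>i. i) \<in> {(m, l). 0 < (m::nat)}"
    by simp
  ultimately obtain m0 l0 where m0: "0 < m0" and "\<phi> (m0, l0) < c + \<delta>"
    using cInf_lessD[of "\<phi> ` {(m, l). 0 < m}" "c + \<delta>"] by blast
  then have l0: "(\<integral>z. (orbit_avg T F m0 l0 z)\<^sup>2 \<partial>M) < c + \<delta>"
    by (simp add: \<phi>_def)
  define n0 where "n0 = Max (l0 ` {..<m0})"
  have n0: "l0 i \<le> n0" if "i < m0" for i
    using that by (auto simp: n0_def)
  obtain N0 where N0: "4 * real n0 / \<delta> < real N0"
    using reals_Archimedean2 by blast
  \<comment> \<open>Averaging a nearly optimal average over \<open>N\<close> further times does not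
    raise its norm, by convexity and invariance. Exchanging the sums turns the result into a mean of
    windows of length \<open>N\<close> shifted by at most \<open>n0\<close>, which is uniformly
    close to the unshifted window.\<close>
  have near: "(\<integral>z. (orbit_avg T F N (\<lambda>i. i) z)\<^sup>2 \<partial>M) \<le> c + 2 * \<delta>" if "N0 \<le> N" for N
  proof -
    have "0 \<le> 4 * real n0 / \<delta>"
      using \<open>0 < \<delta>\<close> by simp
    then have N: "0 < N" "4 * real n0 / \<delta> < real N"
      using N0 that by linarith+
    let ?G = "orbit_avg T F m0 l0"
    define A where "A z = (\<Sum>j<N. ?G ((T ^^ j) z)) / real N" for z
    have A_swap: "A z = (\<Sum>i<m0. orbit_avg T F N ((+) (l0 i)) z) / real m0" for z
    proof -
      have "(\<Sum>j<N. \<Sum>i<m0. F ((T ^^ l0 i) ((T ^^ j) z))) = (\<Sum>i<m0. \<Sum>j<N. F ((T ^^ (l0 i + j)) z))"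
        by (subst sum.swap) (simp add: funpow_add)
      then show ?thesis
        by (simp add: A_def orbit_avg_def sum_divide_distrib[symmetric] mult.commute)
    qed
    have A_diff: "\<bar>A z - orbit_avg T F N (\<lambda>i. i) z\<bar> \<le> 2 * real n0 / real N" for z
    proof -
      have "A z - orbit_avg T F N (\<lambda>i. i) z =
          (\<Sum>i<m0. orbit_avg T F N ((+) (l0 i)) z - orbit_avg T F N (\<lambda>i. i) z) / real m0"
        using m0 by (simp add: A_swap sum_subtractf diff_divide_distrib)
      also have "\<bar>\<dots>\<bar> \<le> (\<Sum>i<m0. 2 * real n0 / real N) / real m0"
        unfolding abs_divide abs_of_nat
      proof (intro divide_right_mono order.trans[OF sum_abs] sum_mono)
        fix i assume i: "i \<in> {..<m0}"
        have "2 * real (l0 i) / real N \<le> 2 * real n0 / real N"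
          using n0[of i] i by (intro divide_right_mono) auto
        then show "\<bar>orbit_avg T F N ((+) (l0 i)) z - orbit_avg T F N (\<lambda>i. i) z\<bar> \<le> 2 * real n0 / real N"
          using orbit_avg_window_diff[of F T N "l0 i" z, OF F1] by linarith
      qed simp
      finally show ?thesis
        using m0 by simp
    qed
    have A1: "\<bar>A z\<bar> \<le> 1" for z
    proof -
      have "\<bar>\<Sum>j<N. ?G ((T ^^ j) z)\<bar> \<le> (\<Sum>j<N. 1)"
        by (intro order.trans[OF sum_abs] sum_mono abs_orbit_avg_le[of F, OF F1])
      then show ?thesis
        using N(1) by (simp add: A_def)
    qed
    have A_meas [measurable]: "A \<in> borel_measurable M"
      unfolding A_def by measurable
    have A_int: "integrable M (\<lambda>z. (A z)\<^sup>2)"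
      by (rule integrable_bounded[of _ 1]) (auto intro!: sq1 A1)
    have G_int: "integrable M (\<lambda>z. (?G ((T ^^ j) z))\<^sup>2)" for j
      by (rule integrable_bounded[of _ 1]) (auto intro!: sq1 abs_orbit_avg_le[of F, OF F1])
    have "(\<integral>z. (A z)\<^sup>2 \<partial>M) \<le> (\<integral>z. (\<Sum>j<N. (?G ((T ^^ j) z))\<^sup>2) / real N \<partial>M)"
      by (intro integral_mono A_int integrable_divide_zero Bochner_Integration.integrable_sum G_int)
         (auto simp: A_def intro: power2_mean_le)
    also have "\<dots> = (\<Sum>j<N. \<integral>z. (?G ((T ^^ j) z))\<^sup>2 \<partial>M) / real N"
      using G_int by simp
    also have "\<dots> = (\<integral>z. (?G z)\<^sup>2 \<partial>M)"
      using N(1) by (subst integral_preserves_measure[OF preserves_measure_funpow[OF T]]) auto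
    finally have A_c: "(\<integral>z. (A z)\<^sup>2 \<partial>M) < c + \<delta>"
      using l0 by simp
    have small: "4 * real n0 / real N \<le> \<delta>"
      using N \<open>0 < \<delta>\<close> by (simp add: field_simps)
    have pt: "(orbit_avg T F N (\<lambda>i. i) z)\<^sup>2 \<le> (A z)\<^sup>2 + \<delta>" for z
    proof -
      let ?b = "orbit_avg T F N (\<lambda>i. i) z"
      have "\<bar>?b\<^sup>2 - (A z)\<^sup>2\<bar> = \<bar>A z - ?b\<bar> * \<bar>?b + A z\<bar>"
        by (simp add: abs_mult[symmetric] power2_eq_square algebra_simps abs_minus_commute)
      also have "\<dots> \<le> (2 * real n0 / real N) * 2"
        using A1[of z] abs_orbit_avg_le[of F T N "\<lambda>i. i" z, OF F1]
        by (intro mult_mono A_diff) auto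
      finally show ?thesis
        using small by simp
    qed
    have "(\<integral>z. (orbit_avg T F N (\<lambda>i. i) z)\<^sup>2 \<partial>M) \<le> (\<integral>z. (A z)\<^sup>2 + \<delta> \<partial>M)"
      using A_int int_sq by (intro integral_mono pt) auto
    also have "\<dots> = (\<integral>z. (A z)\<^sup>2 \<partial>M) + \<delta>"
      using A_int by (simp add: prob_space)
    finally show ?thesis
      using A_c by simp
  qed
  have "(\<integral>z. \<bar>orbit_avg T F N ((+) n) z - orbit_avg T F N (\<lambda>i. i) z\<bar> \<partial>M) \<le> \<epsilon>"
    if N: "Suc N0 \<le> N" for N n
  proof -
    let ?a = "orbit_avg T F N ((+) n)" and ?b = "orbit_avg T F N (\<lambda>i. i)"
    let ?m = "orbit_avg T F (N + N) (\<lambda>i. if i < N then n + i else i - N)"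
    have a2: "(\<integral>z. (?a z)\<^sup>2 \<partial>M) = (\<integral>z. (?b z)\<^sup>2 \<partial>M)"
      unfolding orbit_avg_shift
      by (rule integral_preserves_measure[OF preserves_measure_funpow[OF T], where f = "\<lambda>z. (?b z)\<^sup>2"]) simp
    have par: "(?a z - ?b z)\<^sup>2 = 2 * (?a z)\<^sup>2 + 2 * (?b z)\<^sup>2 - 4 * (?m z)\<^sup>2" for z
    proof -
      have "?a z + ?b z = 2 * ?m z"
        using orbit_avg_midpoint[of T F N "(+) n" z "\<lambda>i. i"] by simp
      then have "(?a z + ?b z)\<^sup>2 = 4 * (?m z)\<^sup>2"
        by simp
      then show ?thesis
        by (simp add: power2_eq_square algebra_simps)
    qed
    have "(\<integral>z. (?a z - ?b z)\<^sup>2 \<partial>M) = 2 * (\<integral>z. (?a z)\<^sup>2 \<partial>M) + 2 * (\<integral>z. (?b z)\<^sup>2 \<partial>M) - 4 * (\<integral>z. (?m z)\<^sup>2 \<partial>M)"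
      unfolding par using int_sq by simp
    also have "\<dots> \<le> 4 * (c + 2 * \<delta>) - 4 * c"
      using near[of N] c_le[of "N + N" "\<lambda>i. if i < N then n + i else i - N"] N a2 by simp
    finally have sq: "(\<integral>z. (?a z - ?b z)\<^sup>2 \<partial>M) \<le> \<epsilon>\<^sup>2"
      by (simp add: \<delta>_def)
    have int2: "integrable M (\<lambda>z. (?a z - ?b z)\<^sup>2)"
      unfolding par using int_sq by simp
    \<comment> \<open>Passes from the quadratic bound to the mean of the absolute value by the
      inequality of arithmetic and geometric means.\<close>
    have pt: "\<bar>x\<bar> \<le> \<epsilon> / 2 + x\<^sup>2 / (2 * \<epsilon>)" for x :: real
    proof -
      have "0 \<le> (\<bar>x\<bar> - \<epsilon>)\<^sup>2"
        by simp
      then show ?thesis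
        using \<open>0 < \<epsilon>\<close> by (simp add: field_simps power2_eq_square)
    qed
    have b2: "\<bar>\<bar>?a z - ?b z\<bar>\<bar> \<le> 2" for z
      using abs_orbit_avg_le[of F T N "(+) n" z, OF F1]
        abs_orbit_avg_le[of F T N "\<lambda>i. i" z, OF F1] by linarith
    have "(\<integral>z. \<bar>?a z - ?b z\<bar> \<partial>M) \<le> (\<integral>z. \<epsilon> / 2 + (?a z - ?b z)\<^sup>2 / (2 * \<epsilon>) \<partial>M)"
    proof (rule integral_mono)
      show "integrable M (\<lambda>z. \<bar>?a z - ?b z\<bar>)"
        by (rule integrable_bounded[of _ 2]) (use b2 in auto)
    qed (use int2 pt in auto)
    also have "\<dots> = \<epsilon> / 2 + (\<integral>z. (?a z - ?b z)\<^sup>2 \<partial>M) / (2 * \<epsilon>)"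
      using int2 by (simp add: prob_space)
    also have "\<dots> \<le> \<epsilon> / 2 + \<epsilon>\<^sup>2 / (2 * \<epsilon>)"
      using sq \<open>0 < \<epsilon>\<close> by (intro add_left_mono divide_right_mono) auto
    also have "\<dots> = \<epsilon>"
      using \<open>0 < \<epsilon>\<close> by (simp add: power2_eq_square)
    finally show ?thesis .
  qed
  then show ?thesis by blast
qed

subsection \<open>Invariant measures dominated by an ergodic measure\<close>

text \<open>Since \<open>T\<close> preserves the measure, the one-step equivalence also holds almost
  surely at each iterate; countably many null sets are then discarded.\<close>

lemma AE_funpow_invariant:
  assumes T: "preserves_measure N T" and E: "E \<in> sets N"
    and AE: "AE x in N. x \<in> E \<longleftrightarrow> T x \<in> E"
  shows "AE x in N. \<forall>n. (T ^^ n) x \<in> E \<longleftrightarrow> x \<in> E"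
proof -
  have "AE x in N. (T ^^ n) x \<in> E \<longleftrightarrow> T ((T ^^ n) x) \<in> E" for n
  proof -
    have Tn: "T ^^ n \<in> measurable N N" "distr N N (T ^^ n) = N"
      using preserves_measure_funpow[OF T] by (auto simp: preserves_measure_def)
    have "AE x in distr N N (T ^^ n). x \<in> E \<longleftrightarrow> T x \<in> E"
      by (subst Tn(2)) (rule AE)
    then show ?thesis
      by (rule AE_distrD[OF Tn(1)])
  qed
  then have "AE x in N. \<forall>n. (T ^^ n) x \<in> E \<longleftrightarrow> T ((T ^^ n) x) \<in> E"
    by (simp add: AE_all_countable)
  then show ?thesis
  proof eventually_elim
    case (elim x)
    show ?case
    proof
      fix n show "(T ^^ n) x \<in> E \<longleftrightarrow> x \<in> E"
        using elim by (induction n) auto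
    qed
  qed
qed

text \<open>\<open>ergodic\<close> speaks of strictly invariant sets. The points that visit
  \<open>E\<close> infinitely often form such a set, and it agrees with \<open>E\<close> almost
  everywhere.\<close>

lemma ergodic_AE_invariant:
  assumes erg: "ergodic N T" and E: "E \<in> sets N"
    and AE: "AE x in N. x \<in> E \<longleftrightarrow> T x \<in> E"
  shows "measure N E = 0 \<or> measure N E = 1"
proof -
  interpret prob_space N
    using erg by (simp add: ergodic_def)
  have T: "preserves_measure N T"
    using erg by (simp add: ergodic_def)
  have Tn [measurable]: "T ^^ n \<in> measurable N N" for n
    using preserves_measure_funpow[OF T] by (auto simp: preserves_measure_def)
  have T_space: "T x \<in> space N" if "x \<in> space N" for x
    using T that by (auto simp: preserves_measure_def dest: measurable_space)
  define E' where "E' = {x \<in> space N. \<exists>\<^sub>\<infinity>n. (T ^^ n) x \<in> E}"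
  have E': "E' \<in> sets N"
    unfolding E'_def INFM_nat using E by measurable
  have iff: "(\<exists>\<^sub>\<infinity>n. (T ^^ n) (T x) \<in> E) \<longleftrightarrow> (\<exists>\<^sub>\<infinity>n. (T ^^ n) x \<in> E)" for x
  proof -
    have "(\<exists>\<^sub>\<infinity>n. (T ^^ n) (T x) \<in> E) \<longleftrightarrow> (\<exists>\<^sub>\<infinity>n. (T ^^ Suc n) x \<in> E)"
      by (simp add: funpow_swap1)
    then show ?thesis
      by (simp only: frequently_def cofinite_eq_sequentially
          eventually_sequentially_Suc[of "\<lambda>n. (T ^^ n) x \<notin> E"])
  qed
  have "T -` E' \<inter> space N = E'"
    by (auto simp: E'_def iff T_space)
  then have "measure N E' = 0 \<or> measure N E' = 1"
    using erg E' by (auto simp: ergodic_def)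
  moreover have "measure N E' = measure N E"
  proof (rule measure_eq_AE)
    show "AE x in N. x \<in> E' \<longleftrightarrow> x \<in> E"
      using AE_funpow_invariant[OF T E AE] AE_space
    proof eventually_elim
      case (elim x)
      then show ?case
        by (simp add: E'_def INFM_const)
    qed
  qed (use E E' in auto)
  ultimately show ?thesis
    by simp
qed

text \<open>The level set of the density \<open>D\<close> of \<open>\<rho>\<close> above its mean \<open>c\<close> is invariant up to a null set,
  hence trivial, and this forces \<open>D = c\<close> almost everywhere.\<close>

lemma ergodic_dominated_invariant_measure:
  assumes erg: "ergodic N T" and sets: "sets \<rho> = sets N"
    and le: "\<And>B. B \<in> sets N \<Longrightarrow> emeasure \<rho> B \<le> emeasure N B"
    and inv: "\<And>B. B \<in> sets N \<Longrightarrow> emeasure \<rho> (T -` B \<inter> space N) = emeasure \<rho> B"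
    and B: "B \<in> sets N"
  shows "measure \<rho> B = measure \<rho> (space N) * measure N B"
proof -
  interpret prob_space N
    using erg by (simp add: ergodic_def)
  have T: "preserves_measure N T"
    using erg by (simp add: ergodic_def)
  have [measurable]: "T \<in> measurable N N"
    using T by (simp add: preserves_measure_def)
  have space: "space \<rho> = space N"
    using sets by (rule sets_eq_imp_space_eq)
  have "emeasure \<rho> (space N) \<le> 1"
    using le[of "space N"] by (simp add: emeasure_space_1)
  then have "finite_measure \<rho>"
    by (intro finite_measureI) (auto simp: space dest: neq_top_trans[rotated])
  then interpret \<rho>: finite_measure \<rho> .
  have "emeasure \<rho> B = 0" if "B \<in> sets N" "emeasure N B = 0" for B
    using le[OF that(1)] that(2) by simp
  then have ac: "absolutely_continuous N \<rho>"
    by (auto simp: absolutely_continuous_def null_sets_def sets)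
  obtain D where D: "D \<in> borel_measurable N" "AE x in N. RN_deriv N \<rho> x = ennreal (D x)"
    "\<And>x. 0 \<le> D x"
    using real_RN_deriv[OF \<open>finite_measure \<rho>\<close> ac sets] by metis
  note [measurable] = D(1)
  have "density N (\<lambda>x. ennreal (D x)) = density N (RN_deriv N \<rho>)"
    using D(2) by (intro density_cong) auto
  also have "\<dots> = \<rho>"
    by (rule density_RN_deriv[OF ac sets])
  finally have dens: "density N (\<lambda>x. ennreal (D x)) = \<rho>" .
  have D_nn: "(\<integral>\<^sup>+x. ennreal (D x * indicator B x) \<partial>N) = emeasure \<rho> B" if "B \<in> sets N" for B
    unfolding dens[symmetric] using that
    by (subst emeasure_density) (auto intro!: nn_integral_cong simp: indicator_def)
  have D_int: "integrable N (\<lambda>x. D x * indicator B x)" if "B \<in> sets N" for B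
    using that D(3) D_nn[OF that]
    by (intro integrableI_nonneg) (auto simp: less_top[symmetric])
  have D_B: "(\<integral>x. D x * indicator B x \<partial>N) = measure \<rho> B" if "B \<in> sets N" for B
    using that D(3) D_nn[OF that] by (subst integral_eq_nn_integral) (auto simp: measure_def)
  define c where "c = measure \<rho> (space N)"
  define a where "a B = measure \<rho> B - c * measure N B" for B
  have c_int: "integrable N (\<lambda>x. c * indicator B x :: real)" if "B \<in> sets N" for B
    using that by (intro integrable_mult_right integrable_real_indicator) (auto simp: less_top[symmetric])
  have a_int: "integrable N (\<lambda>x. (D x - c) * indicator B x)" if "B \<in> sets N" for B
    unfolding left_diff_distrib by (intro Bochner_Integration.integrable_diff D_int c_int that)
  have a_eq: "(\<integral>x. (D x - c) * indicator B x \<partial>N) = a B" if "B \<in> sets N" for B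
    unfolding left_diff_distrib Bochner_Integration.integral_diff[OF D_int[OF that] c_int[OF that]]
    using D_B[OF that] that by (simp add: a_def)
  define E where "E = {x \<in> space N. c < D x}"
  define TE where "TE = T -` E \<inter> space N"
  have E [measurable]: "E \<in> sets N" "TE \<in> sets N"
    by (simp_all add: E_def TE_def)
  have mTE: "measure N TE = measure N E" "measure \<rho> TE = measure \<rho> E"
    using inv[OF E(1)] emeasure_preserves_measure[OF T E(1)] by (simp_all add: measure_def TE_def)
  \<comment> \<open>Nonnegative since \<open>c < D x\<close> holds exactly on \<open>E\<close>: a
    point of \<open>E\<close> outside \<open>TE\<close> contributes positively, one of
    \<open>TE\<close> outside \<open>E\<close> does not contribute negatively. Its integral vanishes
    because both measures are invariant, so \<open>E\<close> lies in \<open>TE\<close> up to a null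
    set.\<close>
  let ?g = "\<lambda>x. (D x - c) * indicator E x - (D x - c) * indicator TE x"
  have "(\<integral>x. ?g x \<partial>N) = a E - a TE"
    using a_int a_eq E by simp
  also have "\<dots> = 0"
    by (simp add: a_def mTE)
  finally have "(\<integral>x. ?g x \<partial>N) = 0" .
  moreover have "integrable N ?g"
    using a_int E by simp
  moreover have "AE x in N. 0 \<le> ?g x"
    by (intro AE_I2) (auto simp: E_def indicator_def)
  ultimately have "AE x in N. ?g x = 0"
    using integral_nonneg_eq_0_iff_AE by blast
  then have sub: "AE x in N. x \<in> E \<longrightarrow> x \<in> TE"
    by eventually_elim (auto simp: E_def indicator_def split: if_splits)
  have "measure N (TE - E) = measure N TE - measure N (TE \<inter> E)"
    using E by (simp add: finite_measure_Diff')
  also have "measure N (TE \<inter> E) = measure N E"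
    using sub E by (intro measure_eq_AE) auto
  finally have "measure N (TE - E) = 0"
    by (simp add: mTE)
  then have "AE x in N. x \<notin> TE - E"
    using E by (intro AE_not_in) (auto simp: null_sets_def emeasure_eq_measure)
  with sub AE_space have AE_E: "AE x in N. x \<in> E \<longleftrightarrow> T x \<in> E"
    by eventually_elim (auto simp: TE_def)
  have "a (space N) = 0"
    by (simp add: a_def c_def prob_space)
  then have int0: "(\<integral>x. (D x - c) \<partial>N) = 0"
    using a_eq[of "space N"] by (simp cong: Bochner_Integration.integral_cong)
  have int_Dc: "integrable N (\<lambda>x. D x - c)"
    using a_int[of "space N"] by (simp cong: Bochner_Integration.integrable_cong)
  have "AE x in N. D x - c = 0"
    using ergodic_AE_invariant[OF erg E(1) AE_E]
  proof
    assume "measure N E = 0"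
    then have "AE x in N. x \<notin> E"
      using E by (intro AE_not_in) (auto simp: null_sets_def emeasure_eq_measure)
    then have "AE x in N. 0 \<le> c - D x"
      using AE_space by eventually_elim (auto simp: E_def)
    moreover have "integrable N (\<lambda>x. c - D x)"
      using Bochner_Integration.integrable_minus[OF int_Dc] by simp
    moreover have "(\<integral>x. c - D x \<partial>N) = 0"
      using int0 Bochner_Integration.integral_minus[of N "\<lambda>x. D x - c"] by simp
    ultimately have "AE x in N. c - D x = 0"
      using integral_nonneg_eq_0_iff_AE[of N "\<lambda>x. c - D x"] by simp
    then show ?thesis
      by eventually_elim simp
  next
    assume "measure N E = 1"
    then have "AE x in N. x \<in> E"
      using E by (simp add: prob_eq_1)
    then have "AE x in N. 0 \<le> D x - c"
      by eventually_elim (auto simp: E_def)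
    then show ?thesis
      using integral_nonneg_eq_0_iff_AE[of N "\<lambda>x. D x - c"] int_Dc int0 by simp
  qed
  then have "(\<integral>x. (D x - c) * indicator B x \<partial>N) = (\<integral>x. 0 \<partial>N)"
    using B by (intro integral_cong_AE) auto
  then have "a B = 0"
    using a_eq[OF B] by simp
  then show ?thesis
    by (simp add: a_def c_def)
qed

subsection \<open>Finitely determined sets\<close>

text \<open>Return windows have finite length, so the relative shift argument can only treat sets
  that read finitely many coordinates. These are stable under intersection and generate the Borel
  sets.\<close>

definition finitely_determined :: "(int \<Rightarrow> 'a) set \<Rightarrow> bool" where
  "finitely_determined A \<longleftrightarrow> (\<exists>m::nat. \<forall>x y. (\<forall>i. \<bar>i\<bar> \<le> int m \<longrightarrow> x i = y i) \<longrightarrow> (x \<in> A \<longleftrightarrow> y \<in> A))"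

lemma finitely_determined_Int:
  assumes "finitely_determined A" "finitely_determined B"
  shows "finitely_determined (A \<inter> B)"
proof -
  obtain m n :: nat where m: "\<And>x y. (\<forall>i. \<bar>i\<bar> \<le> int m \<longrightarrow> x i = y i) \<Longrightarrow> (x \<in> A \<longleftrightarrow> y \<in> A)"
    and n: "\<And>x y. (\<forall>i. \<bar>i\<bar> \<le> int n \<longrightarrow> x i = y i) \<Longrightarrow> (x \<in> B \<longleftrightarrow> y \<in> B)"
    using assms unfolding finitely_determined_def by metis
  have "x \<in> A \<inter> B \<longleftrightarrow> y \<in> A \<inter> B" if "\<forall>i. \<bar>i\<bar> \<le> int (m + n) \<longrightarrow> x i = y i" for x y
    using m[of x y] n[of x y] that by simp
  then show ?thesis
    unfolding finitely_determined_def by blast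
qed

lemma open_finitely_determined:
  fixes A :: "(int \<Rightarrow> nat) set"
  assumes "finitely_determined A"
  shows "open A"
proof -
  obtain m :: nat where m: "\<And>x y. (\<forall>i. \<bar>i\<bar> \<le> int m \<longrightarrow> x i = y i) \<Longrightarrow> (x \<in> A \<longleftrightarrow> y \<in> A)"
    using assms unfolding finitely_determined_def by metis
  have "A = (\<Union>x\<in>A. {y. \<forall>i\<in>{- int m..int m}. y i \<in> {x i}})"
  proof (intro equalityI subsetI)
    fix y assume "y \<in> (\<Union>x\<in>A. {y. \<forall>i\<in>{- int m..int m}. y i \<in> {x i}})"
    then obtain x where "x \<in> A" "\<forall>i\<in>{- int m..int m}. y i = x i"
      by auto
    then show "y \<in> A"
      using m[of x y] by (auto simp: abs_le_iff)
  qed auto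
  also have "open \<dots>"
    by (intro open_UN ballI product_topology_basis')
       (auto simp: discrete_topology_class.open_discrete)
  finally show ?thesis .
qed

lemma sigma_sets_finitely_determined:
  "sigma_sets UNIV {A :: (int \<Rightarrow> nat) set. finitely_determined A} = sets borel"
proof
  show "sigma_sets UNIV {A :: (int \<Rightarrow> nat) set. finitely_determined A} \<subseteq> sets borel"
    using sets.sigma_sets_subset[of _ "borel :: (int \<Rightarrow> nat) measure"]
    by (metis (no_types, lifting) borel_open mem_Collect_eq open_finitely_determined space_borel subsetI)
  have "sets (borel :: (int \<Rightarrow> nat) measure) = sets (\<Pi>\<^sub>M i\<in>UNIV. borel)"
    by (rule sets_PiM_equal_borel[symmetric])
  also have "\<dots> \<subseteq> sigma_sets UNIV {A :: (int \<Rightarrow> nat) set. finitely_determined A}"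
    unfolding sets_PiM_single
  proof (simp, rule sigma_sets_mono, clarify)
    fix i :: int and A :: "nat set"
    have "finitely_determined {f. f i \<in> A}"
      unfolding finitely_determined_def by (rule exI[of _ "nat \<bar>i\<bar>"]) auto
    then show "{f. f i \<in> A} \<in> sigma_sets UNIV {A. finitely_determined A}"
      by auto
  qed
  finally show "sets borel \<subseteq> sigma_sets UNIV {A :: (int \<Rightarrow> nat) set. finitely_determined A}" .
qed

text \<open>Both measures are pushed forward to the full sequence space, where finitely determined
  sets are an intersection-stable generator, and compared there.\<close>

lemma emeasure_eqI_finitely_determined:
  fixes X :: "(int \<Rightarrow> nat) set"
  assumes \<alpha>: "sets \<alpha> = sets (restrict_space borel X)" and \<beta>: "sets \<beta> = sets (restrict_space borel X)"
    and fin: "finite_measure \<alpha>"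
    and eq: "\<And>A. finitely_determined A \<Longrightarrow> emeasure \<alpha> (A \<inter> X) = emeasure \<beta> (A \<inter> X)"
  shows "\<alpha> = \<beta>"
proof (rule measure_eqI)
  have space: "space \<alpha> = X" "space \<beta> = X"
    using sets_eq_imp_space_eq[OF \<alpha>] sets_eq_imp_space_eq[OF \<beta>] by (simp_all add: space_restrict_space)
  have id: "(\<lambda>x. x) \<in> measurable \<alpha> borel" "(\<lambda>x. x) \<in> measurable \<beta> borel"
    using measurable_restrict_space1[OF measurable_ident, where \<Omega> = X]
    by (simp_all add: measurable_cong_sets[OF \<alpha> refl] measurable_cong_sets[OF \<beta> refl] id_def)
  have e: "emeasure (distr \<alpha> borel (\<lambda>x. x)) A = emeasure \<alpha> (A \<inter> X)"
    "emeasure (distr \<beta> borel (\<lambda>x. x)) A = emeasure \<beta> (A \<inter> X)" if "A \<in> sets borel" for A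
    using that by (simp_all add: emeasure_distr id space)
  have fd_borel: "A \<in> sets borel" if "finitely_determined A" for A :: "(int \<Rightarrow> nat) set"
    using that by (intro borel_open open_finitely_determined)
  have UNIV: "finitely_determined (UNIV :: (int \<Rightarrow> nat) set)"
    by (simp add: finitely_determined_def)
  have "distr \<alpha> borel (\<lambda>x. x) = distr \<beta> borel (\<lambda>x. x)"
  proof (rule measure_eqI_generator_eq[where E = "{A. finitely_determined A}" and \<Omega> = UNIV and A = "\<lambda>_. UNIV"])
    show "Int_stable {A :: (int \<Rightarrow> nat) set. finitely_determined A}"
      by (auto simp: Int_stable_def finitely_determined_Int)
    show "emeasure (distr \<alpha> borel (\<lambda>x. x)) UNIV \<noteq> \<infinity>"
      using finite_measure.emeasure_finite[OF fin] e(1)[of UNIV] by simp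
  qed (auto simp: sigma_sets_finitely_determined e fd_borel eq UNIV)
  then have "emeasure \<alpha> (A \<inter> X) = emeasure \<beta> (A \<inter> X)" if "A \<in> sets borel" for A
    using e[OF that] by simp
  then show "emeasure \<alpha> A = emeasure \<beta> A" if "A \<in> sets \<alpha>" for A
    using that by (auto simp: \<alpha> sets_restrict_space Int_commute)
qed (simp add: \<alpha> \<beta>)

subsection \<open>Relative shifts of joinings\<close>

lemma shift_map_funpow: "(shift_map ^^ n) x i = x (i + int n)"
  by (induction n arbitrary: i) (simp_all add: shift_map_def add.assoc add.commute[of 1])

lemma map_prod_funpow:
  fixes f :: "'a \<Rightarrow> 'a" and g :: "'b \<Rightarrow> 'b"
  shows "(map_prod f g ^^ n) z = ((f ^^ n) (fst z), (g ^^ n) (snd z))"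
  by (induction n) simp_all

lemma abs_diff_chain_le:
  fixes a :: "nat \<Rightarrow> real"
  assumes "\<And>i. i < n \<Longrightarrow> \<bar>a i - a (Suc i)\<bar> \<le> D"
  shows "\<bar>a 0 - a n\<bar> \<le> real n * D"
  using assms
proof (induction n)
  case (Suc n)
  then have "\<bar>a 0 - a n\<bar> \<le> real n * D" "\<bar>a n - a (Suc n)\<bar> \<le> D"
    by simp_all
  then show ?case
    by (simp add: algebra_simps)
qed simp

text \<open>\<open>C\<close> is to stay fixed while \<open>h\<close> grows; \<open>st\<close>,
  \<alpha> and \<beta> may vary with the point, with no measurability required.\<close>

definition return_windows :: "nat \<Rightarrow> nat \<Rightarrow> ((int \<Rightarrow> 'a) \<times> (int \<Rightarrow> 'a)) set \<Rightarrow> nat \<Rightarrow> bool" where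
  "return_windows S C Z h \<longleftrightarrow> (\<forall>z\<in>Z. \<exists>st \<alpha> \<beta>. \<alpha> \<le> S \<and> \<beta> \<le> S \<and> \<alpha> \<noteq> \<beta> \<and> st \<le> C * h \<and>
     (\<forall>\<tau>. st \<le> \<tau> \<longrightarrow> \<tau> + S < st + h div 2 \<longrightarrow>
        fst z (int \<tau>) = fst z (int (\<tau> + h + \<alpha>)) \<and> snd z (int \<tau>) = snd z (int (\<tau> + h + \<beta>))))"

text \<open>On a return window the average of \<open>F (e + \<alpha>)\<close> equals that of \<open>F (e + \<beta>)\<close> on the translated
  window. As all window averages of one function agree up to a small \<open>L\<^sup>1\<close> error, moving in steps
  \<open>\<bar>\<alpha> - \<beta>\<bar>\<close>, each a divisor of \<open>K\<close>, leads from \<open>F S\<close> to \<open>F (S + K)\<close>, although \<open>\<alpha>\<close> and \<open>\<beta>\<close> depend on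
  the point.\<close>

lemma measure_relative_shift_eq:
  fixes L :: "((int \<Rightarrow> nat) \<times> (int \<Rightarrow> nat)) measure"
  defines "T \<equiv> map_prod shift_map shift_map"
  assumes "prob_space L" and T: "preserves_measure L T"
    and A: "\<And>x y. (\<And>c. c < m \<Longrightarrow> x (int c) = y (int c)) \<Longrightarrow> x \<in> A \<longleftrightarrow> y \<in> A"
    and B: "\<And>x y. (\<And>c. c < m \<Longrightarrow> x (int c) = y (int c)) \<Longrightarrow> x \<in> B \<longleftrightarrow> y \<in> B"
    and meas: "\<And>e. {z \<in> space L. fst z \<in> A \<and> (shift_map ^^ e) (snd z) \<in> B} \<in> sets L"
    and windows: "\<And>h0. \<exists>h\<ge>h0. return_windows S C (space L) h"
    and K: "0 < K" "\<And>d. 0 < d \<Longrightarrow> d \<le> S \<Longrightarrow> d dvd K"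
  shows "measure L {z \<in> space L. fst z \<in> A \<and> (shift_map ^^ S) (snd z) \<in> B} =
    measure L {z \<in> space L. fst z \<in> A \<and> (shift_map ^^ (S + K)) (snd z) \<in> B}"
proof -
  interpret prob_space L by fact
  define F :: "nat \<Rightarrow> (int \<Rightarrow> nat) \<times> (int \<Rightarrow> nat) \<Rightarrow> real"
    where "F e = indicator {z. fst z \<in> A \<and> (shift_map ^^ e) (snd z) \<in> B}" for e
  have F_meas [measurable]: "F e \<in> borel_measurable L" for e
  proof -
    have "F e \<in> borel_measurable L \<longleftrightarrow>
        (indicator {z \<in> space L. fst z \<in> A \<and> (shift_map ^^ e) (snd z) \<in> B} :: _ \<Rightarrow> real) \<in> borel_measurable L"
      by (rule measurable_cong) (simp add: F_def indicator_def)
    then show ?thesis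
      using meas[of e] by simp
  qed
  have F1: "\<bar>F e z\<bar> \<le> 1" for e z
    by (simp add: F_def indicator_def)
  have F_int: "(\<integral>z. F e z \<partial>L) = measure L {z \<in> space L. fst z \<in> A \<and> (shift_map ^^ e) (snd z) \<in> B}" for e
  proof -
    have "(\<integral>z. F e z \<partial>L) = (\<integral>z. indicator {z \<in> space L. fst z \<in> A \<and> (shift_map ^^ e) (snd z) \<in> B} z \<partial>L)"
      by (intro Bochner_Integration.integral_cong) (simp_all add: F_def indicator_def)
    then show ?thesis
      using meas[of e] by simp
  qed
  have meas_avg [measurable]: "orbit_avg T (F e) N l \<in> borel_measurable L" for e N l
    by (rule borel_measurable_orbit_avg[OF preserves_measure_measurable[OF T] F_meas])
  have int_avg: "integrable L (orbit_avg T (F e) N l)" for e N l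
    by (intro integrable_const_bound[of _ 1] meas_avg AE_I2)
       (simp add: abs_orbit_avg_le[of "F e", OF F1])
  have avg_int: "(\<integral>z. orbit_avg T (F e) N (\<lambda>i. i) z \<partial>L) = (\<integral>z. F e z \<partial>L)" if "0 < N" for e N
  proof -
    have [measurable]: "T ^^ n \<in> measurable L L" for n
      using preserves_measure_funpow[OF T] by (simp add: preserves_measure_def)
    have "integrable L (\<lambda>z. F e ((T ^^ n) z))" for n
      by (intro integrable_const_bound[of _ 1]) (auto simp: F1)
    then show ?thesis
      using that
      by (simp add: orbit_avg_def integral_preserves_measure[OF preserves_measure_funpow[OF T] F_meas])
  qed
  have bound: "\<bar>(\<integral>z. F S z \<partial>L) - (\<integral>z. F (S + K) z \<partial>L)\<bar> \<le> \<epsilon>" if "0 < \<epsilon>" for \<epsilon>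
  proof -
    \<comment> \<open>\<open>E\<close> bounds the relative shifts e + \<alpha>, \<open>R\<close>
      counts the offsets 0 and h + \<alpha> with \<alpha> \<le> S, and \<open>J\<close> bounds the
      grid index: st \<le> C * h \<le> 16 * C * N, and rounding up adds one. \<eta> divides
      \<epsilon> by the number of terms of \<Delta> and by the factor 2 * K of the chain.\<close>
    define E where "E = K + 2 * S"
    define R where "R = S + 2"
    define J where "J = 16 * C + 1"
    define \<eta> where "\<eta> = \<epsilon> / (2 * real K * (real (Suc E) * real (Suc J) * real R))"
    have "0 < \<eta>"
      using \<open>0 < \<epsilon>\<close> K(1) by (simp add: \<eta>_def R_def)
    have "\<exists>N0. \<forall>N\<ge>N0. \<forall>n. (\<integral>z. \<bar>orbit_avg T (F e) N ((+) n) z - orbit_avg T (F e) N (\<lambda>i. i) z\<bar> \<partial>L) \<le> \<eta>" for e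
      by (rule orbit_avg_windows_close[OF prob_space_axioms T F_meas F1 \<open>0 < \<eta>\<close>])
    then obtain N0 where N0: "\<And>e N n. N0 e \<le> N \<Longrightarrow>
        (\<integral>z. \<bar>orbit_avg T (F e) N ((+) n) z - orbit_avg T (F e) N (\<lambda>i. i) z\<bar> \<partial>L) \<le> \<eta>"
      by metis
    define N1 where "N1 = (\<Sum>e\<le>E. N0 e)"
    have N1: "N0 e \<le> N1" if "e \<le> E" for e
      using that by (auto simp: N1_def intro: member_le_sum)
    \<comment> \<open>Half of \<open>h\<close> must hold the rounding loss and a window, each of
      length \<open>N\<close> at most, as well as the \<open>m\<close> coordinates read and the
      largest relative shift.\<close>
    obtain h where h: "8 * N1 + 8 + 4 * m + 4 * K + 12 * S \<le> h" and "return_windows S C (space L) h"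
      using windows by blast
    note win = this(2)[unfolded return_windows_def, rule_format]
    define N where "N = h div 8"
    define h2 where "h2 = h div 2"
    have "h < 8 * N + 8" "8 * N \<le> h" "h \<le> 2 * h2 + 1"
      unfolding N_def h2_def by presburger+
    moreover from this h have "0 < N"
      by linarith
    ultimately have N: "N1 \<le> N" "0 < N" "h \<le> 16 * N" "2 * N + m + K + 3 * S \<le> h div 2"
      using h unfolding h2_def[symmetric] by linarith+
    \<comment> \<open>Case 0 is a grid window, case \<open>Suc \<alpha>\<close> the same window
      moved by the return time h + \<alpha>.\<close>
    define pos where "pos j a = (case a of 0 \<Rightarrow> j * N | Suc \<alpha> \<Rightarrow> j * N + h + \<alpha>)" for j a
    define d where "d e n z = \<bar>orbit_avg T (F e) N ((+) n) z - orbit_avg T (F e) N (\<lambda>i. i) z\<bar>" for e n z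
    define \<Delta> where "\<Delta> z = (\<Sum>e\<le>E. \<Sum>j\<le>J. \<Sum>a<R. d e (pos j a) z)" for z
    have d_nonneg: "0 \<le> d e n z" for e n z
      by (simp add: d_def)
    have d_le: "d e (pos j a) z \<le> \<Delta> z" if "e \<le> E" "j \<le> J" "a < R" for e j a z
    proof -
      have "d e (pos j a) z \<le> (\<Sum>a<R. d e (pos j a) z)"
        using that by (intro member_le_sum[of a]) (auto simp: d_nonneg)
      also have "\<dots> \<le> (\<Sum>j\<le>J. \<Sum>a<R. d e (pos j a) z)"
        using that by (intro member_le_sum[of j "{..J}" "\<lambda>j. \<Sum>a<R. d e (pos j a) z"])
          (auto simp: d_nonneg intro: sum_nonneg)
      also have "\<dots> \<le> \<Delta> z"
        unfolding \<Delta>_def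
        using that by (intro member_le_sum[of e "{..E}" "\<lambda>e. \<Sum>j\<le>J. \<Sum>a<R. d e (pos j a) z"])
          (auto simp: d_nonneg intro!: sum_nonneg)
      finally show ?thesis .
    qed
    have int_d: "integrable L (d e n)" for e n
      unfolding d_def using int_avg by simp
    then have int_\<Delta>: "integrable L \<Delta>"
      unfolding \<Delta>_def by (intro Bochner_Integration.integrable_sum) auto
    have "(\<integral>z. \<Delta> z \<partial>L) = (\<Sum>e\<le>E. \<Sum>j\<le>J. \<Sum>a<R. \<integral>z. d e (pos j a) z \<partial>L)"
      unfolding \<Delta>_def using int_d by (simp add: Bochner_Integration.integral_sum Bochner_Integration.integrable_sum)
    also have "\<dots> \<le> (\<Sum>e\<le>E. \<Sum>j\<le>J. \<Sum>a<R. \<eta>)"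
      using N0 N1 N(1) unfolding d_def by (intro sum_mono) (meson atMost_iff le_trans)
    also have "\<dots> = real (Suc E) * real (Suc J) * real R * \<eta>"
      by simp
    finally have \<Delta>_bound: "(\<integral>z. \<Delta> z \<partial>L) \<le> real (Suc E) * real (Suc J) * real R * \<eta>" .
    have key: "\<bar>orbit_avg T (F S) N (\<lambda>i. i) z - orbit_avg T (F (S + K)) N (\<lambda>i. i) z\<bar> \<le> 2 * real K * \<Delta> z"
      if z: "z \<in> space L" for z
    proof -
      obtain st \<alpha> \<beta> where ab: "\<alpha> \<le> S" "\<beta> \<le> S" "\<alpha> \<noteq> \<beta>" and st: "st \<le> C * h"
        and rep: "\<And>\<tau>. st \<le> \<tau> \<Longrightarrow> \<tau> + S < st + h div 2 \<Longrightarrow>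
          fst z (int \<tau>) = fst z (int (\<tau> + h + \<alpha>)) \<and> snd z (int \<tau>) = snd z (int (\<tau> + h + \<beta>))"
        using win[OF z] by blast
      define j where "j = Suc (st div N)"
      have jN: "st \<le> j * N" "j * N \<le> st + N"
        using N(2) by (simp_all add: j_def dividend_less_div_times less_imp_le)
      have "st \<le> C * (16 * N)"
        using st mult_le_mono2[OF N(3), of C] by (rule le_trans)
      then have "st \<le> (16 * C) * N"
        by (simp only: ac_simps)
      then have "st div N \<le> 16 * C"
        using N(2) by (metis div_le_mono nonzero_mult_div_cancel_right not_gr_zero)
      then have jJ: "j \<le> J"
        by (simp add: j_def J_def)
      \<comment> \<open>Moving time forward by h + \<alpha> repeats the first coordinate. The second
        repeats after h + \<beta>, so what was read at relative shift e + \<alpha> is now read at e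
        + \<beta>.\<close>
      have shift: "orbit_avg T (F (e + \<alpha>)) N ((+) (j * N)) z = orbit_avg T (F (e + \<beta>)) N ((+) (j * N + h + \<alpha>)) z"
        if e: "e \<le> K + S" for e
      proof -
        have "F (e + \<alpha>) ((T ^^ (j * N + i)) z) = F (e + \<beta>) ((T ^^ (j * N + h + \<alpha> + i)) z)"
          if i: "i < N" for i
        proof -
          let ?\<tau> = "j * N + i"
          have range: "st \<le> ?\<tau> + c" "?\<tau> + c + S < st + h div 2" if "c < m + (K + 2 * S)" for c
            using jN i N(4) that by simp_all
          have "(shift_map ^^ ?\<tau>) (fst z) \<in> A \<longleftrightarrow> (shift_map ^^ (j * N + h + \<alpha> + i)) (fst z) \<in> A"
          proof (rule A)
            fix c assume "c < m"
            then show "(shift_map ^^ ?\<tau>) (fst z) (int c) = (shift_map ^^ (j * N + h + \<alpha> + i)) (fst z) (int c)"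
              using rep[OF range, of c] by (simp add: shift_map_funpow algebra_simps)
          qed
          moreover have "(shift_map ^^ (e + \<alpha>)) ((shift_map ^^ ?\<tau>) (snd z)) \<in> B \<longleftrightarrow>
              (shift_map ^^ (e + \<beta>)) ((shift_map ^^ (j * N + h + \<alpha> + i)) (snd z)) \<in> B"
          proof (rule B)
            fix c assume "c < m"
            then have "e + \<alpha> + c < m + (K + 2 * S)"
              using e ab by simp
            from rep[OF range[OF this]]
            show "(shift_map ^^ (e + \<alpha>)) ((shift_map ^^ ?\<tau>) (snd z)) (int c) =
              (shift_map ^^ (e + \<beta>)) ((shift_map ^^ (j * N + h + \<alpha> + i)) (snd z)) (int c)"
              by (simp add: shift_map_funpow algebra_simps)
          qed
          ultimately show ?thesis
            by (simp add: F_def T_def map_prod_funpow indicator_def)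
        qed
        then show ?thesis
          by (simp add: orbit_avg_def)
      qed
      let ?a = "\<lambda>e. orbit_avg T (F e) N (\<lambda>i. i) z"
      have step: "\<bar>?a (e + \<alpha>) - ?a (e + \<beta>)\<bar> \<le> 2 * \<Delta> z" if e: "e \<le> K + S" for e
      proof -
        have "d (e + \<alpha>) (pos j 0) z \<le> \<Delta> z" "d (e + \<beta>) (pos j (Suc \<alpha>)) z \<le> \<Delta> z"
          using e ab jJ by (auto intro!: d_le simp: E_def R_def)
        then show ?thesis
          using shift[OF e] unfolding d_def pos_def by simp
      qed
      define \<gamma> where "\<gamma> = max \<alpha> \<beta> - min \<alpha> \<beta>"
      have \<gamma>: "0 < \<gamma>" "\<gamma> \<le> S" "max \<alpha> \<beta> = min \<alpha> \<beta> + \<gamma>"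
        using ab by (auto simp: \<gamma>_def)
      then obtain n where n: "K = \<gamma> * n"
        using K(2) by (meson dvdE)
      have "\<bar>?a (S + \<gamma> * 0) - ?a (S + \<gamma> * n)\<bar> \<le> real n * (2 * \<Delta> z)"
      proof (rule abs_diff_chain_le)
        fix i assume i: "i < n"
        \<comment> \<open>The chain starts at relative shift \<open>S\<close> and not 0 so that this
          subtraction is exact: the smaller of \<alpha> and \<beta> is at most
          \<open>S\<close>.\<close>
        define e where "e = S - min \<alpha> \<beta> + \<gamma> * i"
        have "\<gamma> * i \<le> K"
          using i by (simp add: n)
        then have "e \<le> K + S"
          by (simp add: e_def)
        then have "\<bar>?a (e + \<alpha>) - ?a (e + \<beta>)\<bar> \<le> 2 * \<Delta> z"
          by (rule step)
        then have "\<bar>?a (e + min \<alpha> \<beta>) - ?a (e + max \<alpha> \<beta>)\<bar> \<le> 2 * \<Delta> z"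
          by (auto simp: min_def max_def abs_minus_commute)
        moreover have "e + min \<alpha> \<beta> = S + \<gamma> * i" "e + max \<alpha> \<beta> = S + \<gamma> * Suc i"
          using ab \<gamma>(3) by (auto simp: e_def min_def)
        ultimately show "\<bar>?a (S + \<gamma> * i) - ?a (S + \<gamma> * Suc i)\<bar> \<le> 2 * \<Delta> z"
          by simp
      qed
      moreover have "real n * (2 * \<Delta> z) \<le> real K * (2 * \<Delta> z)"
      proof (rule mult_right_mono)
        show "real n \<le> real K"
          unfolding of_nat_le_iff using \<gamma>(1) by (simp add: n)
        show "0 \<le> 2 * \<Delta> z"
          unfolding \<Delta>_def by (auto intro!: sum_nonneg simp: d_nonneg)
      qed
      ultimately show ?thesis
        by (simp add: n)
    qed
    have "\<bar>(\<integral>z. F S z \<partial>L) - (\<integral>z. F (S + K) z \<partial>L)\<bar> =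
        \<bar>\<integral>z. orbit_avg T (F S) N (\<lambda>i. i) z - orbit_avg T (F (S + K)) N (\<lambda>i. i) z \<partial>L\<bar>"
      using int_avg N(2) by (simp add: avg_int)
    also have "\<dots> \<le> (\<integral>z. \<bar>orbit_avg T (F S) N (\<lambda>i. i) z - orbit_avg T (F (S + K)) N (\<lambda>i. i) z\<bar> \<partial>L)"
      by (rule integral_abs_bound)
    also have "\<dots> \<le> (\<integral>z. 2 * real K * \<Delta> z \<partial>L)"
      using int_avg int_\<Delta> key by (intro integral_mono) auto
    also have "\<dots> = 2 * real K * (\<integral>z. \<Delta> z \<partial>L)"
      by simp
    also have "\<dots> \<le> 2 * real K * (real (Suc E) * real (Suc J) * real R * \<eta>)"
      using \<Delta>_bound by (intro mult_left_mono) auto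
    also have "\<dots> = \<epsilon>"
      using K(1) by (simp add: \<eta>_def R_def del: of_nat_Suc of_nat_add)
    finally show ?thesis .
  qed
  have "\<bar>(\<integral>z. F S z \<partial>L) - (\<integral>z. F (S + K) z \<partial>L)\<bar> \<le> 0"
  proof (rule field_le_epsilon)
    fix \<epsilon> :: real assume "0 < \<epsilon>"
    from bound[OF this] show "\<bar>(\<integral>z. F S z \<partial>L) - (\<integral>z. F (S + K) z \<partial>L)\<bar> \<le> 0 + \<epsilon>"
      by simp
  qed
  then show ?thesis
    by (simp add: F_int)
qed

section \<open>Fixing one side of the rectangles: from relative invariance to the product
  formula\<close>

lemma emeasure_distr_restrict_snd:
  assumes L: "sets L = sets (M \<Otimes>\<^sub>M N)" and A: "A \<in> sets M" and B: "B \<in> sets N"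
  shows "emeasure (distr (restrict_space L (A \<times> space N)) N snd) B = emeasure L (A \<times> B)"
proof -
  have space: "space L = space M \<times> space N"
    using sets_eq_imp_space_eq[OF L] by (simp add: space_pair_measure)
  have \<Omega>: "A \<times> space N \<inter> space L \<in> sets L"
    using A unfolding space L by auto
  have snd: "snd \<in> measurable (restrict_space L (A \<times> space N)) N"
    by (intro measurable_restrict_space1) (simp add: measurable_cong_sets[OF L refl])
  have "snd -` B \<inter> space (restrict_space L (A \<times> space N)) = A \<times> B"
    using sets.sets_into_space[OF A] sets.sets_into_space[OF B]
    by (auto simp: space_restrict_space space)
  moreover have "A \<times> B \<subseteq> A \<times> space N"
    using sets.sets_into_space[OF B] by auto
  ultimately show ?thesis
    by (simp add: emeasure_distr[OF snd B] emeasure_restrict_space[OF \<Omega>])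
qed

lemma emeasure_distr_restrict_fst:
  assumes L: "sets L = sets (M \<Otimes>\<^sub>M N)" and A: "A \<in> sets M" and B: "B \<in> sets N"
  shows "emeasure (distr (restrict_space L (space M \<times> B)) M fst) A = emeasure L (A \<times> B)"
proof -
  have space: "space L = space M \<times> space N"
    using sets_eq_imp_space_eq[OF L] by (simp add: space_pair_measure)
  have \<Omega>: "space M \<times> B \<inter> space L \<in> sets L"
    using B unfolding space L by auto
  have fst: "fst \<in> measurable (restrict_space L (space M \<times> B)) M"
    by (intro measurable_restrict_space1) (simp add: measurable_cong_sets[OF L refl])
  have "fst -` A \<inter> space (restrict_space L (space M \<times> B)) = A \<times> B"
    using sets.sets_into_space[OF A] sets.sets_into_space[OF B]
    by (auto simp: space_restrict_space space)
  moreover have "A \<times> B \<subseteq> space M \<times> B"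
    using sets.sets_into_space[OF A] by auto
  ultimately show ?thesis
    by (simp add: emeasure_distr[OF fst A] emeasure_restrict_space[OF \<Omega>])
qed

lemma emeasure_joining_marginals:
  assumes L: "sets L = sets (M \<Otimes>\<^sub>M N)" and fst: "distr L M fst = M" and snd: "distr L N snd = N"
  shows "A \<in> sets M \<Longrightarrow> emeasure L (A \<times> space N) = emeasure M A"
    and "B \<in> sets N \<Longrightarrow> emeasure L (space M \<times> B) = emeasure N B"
proof -
  have space: "space L = space M \<times> space N"
    using sets_eq_imp_space_eq[OF L] by (simp add: space_pair_measure)
  have meas: "fst \<in> measurable L M" "snd \<in> measurable L N"
    by (simp_all add: measurable_cong_sets[OF L refl])
  show "emeasure L (A \<times> space N) = emeasure M A" if A: "A \<in> sets M"
  proof -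
    have "fst -` A \<inter> space L = A \<times> space N"
      using sets.sets_into_space[OF A] by (auto simp: space)
    then show ?thesis
      using emeasure_distr[OF meas(1) A] fst by simp
  qed
  show "emeasure L (space M \<times> B) = emeasure N B" if B: "B \<in> sets N"
  proof -
    have "snd -` B \<inter> space L = space M \<times> B"
      using sets.sets_into_space[OF B] by (auto simp: space)
    then show ?thesis
      using emeasure_distr[OF meas(2) B] snd by simp
  qed
qed

lemma sets_restrict_space_finitely_determined:
  fixes A :: "(int \<Rightarrow> nat) set"
  assumes "finitely_determined A"
  shows "A \<inter> X \<in> sets (restrict_space borel X)"
  unfolding sets_restrict_space Int_commute[of A X]
  by (intro imageI borel_open open_finitely_determined assms)

text \<open>For finitely determined \<open>A\<close>, the measure L(A \<times> _) is dominated by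
  \<open>N\<close> and invariant under \<open>R\<close>, so ergodicity makes it a multiple of
  \<open>N\<close>. With an arbitrary \<open>B\<close> then fixed, the formula extends to all
  \<open>A\<close> by comparing two measures in the first coordinate.\<close>

lemma emeasure_joining_eq_mult:
  fixes M N :: "(int \<Rightarrow> nat) measure"
  assumes L: "sets L = sets (M \<Otimes>\<^sub>M N)" and marg: "distr L M fst = M" "distr L N snd = N"
    and M: "sets M = sets (restrict_space borel X)" "prob_space M"
    and N: "sets N = sets (restrict_space borel Y)" "ergodic N R"
    and inv: "\<And>A B. finitely_determined A \<Longrightarrow> finitely_determined B \<Longrightarrow>
      emeasure L ((A \<inter> X) \<times> (R -` (B \<inter> Y) \<inter> Y)) = emeasure L ((A \<inter> X) \<times> (B \<inter> Y))"
    and A: "A \<in> sets M" and B: "B \<in> sets N"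
  shows "emeasure L (A \<times> B) = emeasure M A * emeasure N B"
proof -
  interpret M: prob_space M by fact
  interpret N: prob_space N
    using N by (simp add: ergodic_def)
  have R: "R \<in> measurable N N"
    using N by (simp add: ergodic_def preserves_measure_def)
  have space: "space M = X" "space N = Y"
    using sets_eq_imp_space_eq[OF M(1)] sets_eq_imp_space_eq[OF N(1)]
    by (simp_all add: space_restrict_space)
  have fd: "A \<inter> X \<in> sets M" "A \<inter> Y \<in> sets N" if "finitely_determined A" for A
    unfolding M(1) N(1) by (intro sets_restrict_space_finitely_determined that)+
  have L_le: "emeasure L (A \<times> B) \<le> emeasure N B" if "A \<in> sets M" "B \<in> sets N" for A B
  proof -
    have "emeasure L (A \<times> B) \<le> emeasure L (space M \<times> B)"
      using that sets.sets_into_space[OF that(1)] by (intro emeasure_mono) (auto simp: L)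
    then show ?thesis
      using emeasure_joining_marginals(2)[OF L marg that(2)] by simp
  qed
  have fd_case: "emeasure L ((A \<inter> X) \<times> B) = emeasure M (A \<inter> X) * emeasure N B"
    if A: "finitely_determined A" and B: "B \<in> sets N" for A B
  proof -
    define \<rho> where "\<rho> = distr (restrict_space L ((A \<inter> X) \<times> space N)) N snd"
    have \<rho>: "emeasure \<rho> B = emeasure L ((A \<inter> X) \<times> B)" if "B \<in> sets N" for B
      unfolding \<rho>_def by (rule emeasure_distr_restrict_snd[OF L fd(1)[OF A] that])
    have sets_\<rho>: "sets \<rho> = sets N"
      by (simp add: \<rho>_def)
    have R\<rho>: "R \<in> measurable \<rho> N"
      using R by (simp add: measurable_cong_sets[OF sets_\<rho> refl])
    have le: "emeasure \<rho> B \<le> emeasure N B" if "B \<in> sets N" for B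
      using L_le[OF fd(1)[OF A] that] \<rho>[OF that] by simp
    have "emeasure \<rho> (space \<rho>) \<le> 1"
      using le[of "space N"] by (simp add: \<rho>_def N.emeasure_space_1)
    then have fin: "finite_measure \<rho>"
      by (intro finite_measureI) (auto dest: neq_top_trans[rotated])
    have pre: "emeasure (distr \<rho> N R) B = emeasure \<rho> (R -` B \<inter> space N)" if "B \<in> sets N" for B
      using emeasure_distr[OF R\<rho> that] by (simp add: \<rho>_def)
    have "\<rho> = distr \<rho> N R"
    proof (rule emeasure_eqI_finitely_determined[of _ Y])
      fix B :: "(int \<Rightarrow> nat) set" assume B: "finitely_determined B"
      have "R -` (B \<inter> Y) \<inter> space N \<in> sets N"
        using R fd(2)[OF B] by (rule measurable_sets)
      then show "emeasure \<rho> (B \<inter> Y) = emeasure (distr \<rho> N R) (B \<inter> Y)"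
        using \<rho>[OF fd(2)[OF B]] \<rho>[of "R -` (B \<inter> Y) \<inter> space N"] inv[OF A B]
        by (simp add: pre fd(2)[OF B] space)
    qed (use fin in \<open>simp_all add: sets_\<rho> N(1)\<close>)
    then have inv\<rho>: "emeasure \<rho> (R -` B \<inter> space N) = emeasure \<rho> B" if "B \<in> sets N" for B
      using pre[OF that] by simp
    have "measure \<rho> B = measure \<rho> (space N) * measure N B"
      by (rule ergodic_dominated_invariant_measure[OF N(2) sets_\<rho> le inv\<rho> B])
    moreover have "measure \<rho> (space N) = measure M (A \<inter> X)"
      using \<rho>[of "space N"] emeasure_joining_marginals(1)[OF L marg fd(1)[OF A]]
      by (simp add: measure_def)
    ultimately have "emeasure \<rho> B = emeasure M (A \<inter> X) * emeasure N B"
      by (simp add: finite_measure.emeasure_eq_measure[OF fin] M.emeasure_eq_measure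
          N.emeasure_eq_measure ennreal_mult)
    then show ?thesis
      using \<rho>[OF B] by simp
  qed
  define \<alpha> where "\<alpha> = distr (restrict_space L (space M \<times> B)) M fst"
  have \<alpha>: "emeasure \<alpha> A = emeasure L (A \<times> B)" if "A \<in> sets M" for A
    unfolding \<alpha>_def by (rule emeasure_distr_restrict_fst[OF L that B])
  have "emeasure \<alpha> (space \<alpha>) \<le> 1"
    using \<alpha>[of "space M"] L_le[of "space M" B] B N.emeasure_le_1[of B] by (simp add: \<alpha>_def)
  then have "finite_measure \<alpha>"
    by (intro finite_measureI) (auto dest: neq_top_trans[rotated])
  then have "\<alpha> = scale_measure (emeasure N B) M"
  proof (rule emeasure_eqI_finitely_determined[of _ X, rotated 2])
    fix A :: "(int \<Rightarrow> nat) set" assume "finitely_determined A"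
    then show "emeasure \<alpha> (A \<inter> X) = emeasure (scale_measure (emeasure N B) M) (A \<inter> X)"
      using fd_case[OF _ B, of A] fd(1)[of A] by (simp add: \<alpha> mult.commute)
  qed (simp_all add: \<alpha>_def M(1))
  then show ?thesis
    using \<alpha>[OF A] by (simp add: mult.commute)
qed

section \<open>Return windows in rank-one shift spaces and the resulting invariance of
  joinings\<close>

lemma finitely_determined_shift:
  assumes "finitely_determined A"
  shows "finitely_determined ((shift_map ^^ n) -` A)"
proof -
  obtain m :: nat where m: "\<And>x y. (\<forall>i. \<bar>i\<bar> \<le> int m \<longrightarrow> x i = y i) \<Longrightarrow> (x \<in> A \<longleftrightarrow> y \<in> A)"
    using assms unfolding finitely_determined_def by metis
  have "x \<in> (shift_map ^^ n) -` A \<longleftrightarrow> y \<in> (shift_map ^^ n) -` A"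
    if "\<forall>i. \<bar>i\<bar> \<le> int (m + n) \<longrightarrow> x i = y i" for x y
    unfolding vimage_eq by (rule m) (use that in \<open>auto simp: shift_map_funpow\<close>)
  then show ?thesis
    unfolding finitely_determined_def by blast
qed

lemma word_shift_space_window:
  assumes "x \<in> word_shift_space V"
  obtains k where "\<And>i. i < n \<Longrightarrow> x (int i) = V (k + i)"
proof -
  let ?u = "map (\<lambda>i. x (int i)) [0..<n]"
  have "subword_of_biinfinite ?u x"
    unfolding subword_of_biinfinite_def by (rule exI[of _ 0]) simp
  then have "subword_of_infinite ?u V"
    using assms by (simp add: word_shift_space_def)
  then obtain k where k: "?u = map (\<lambda>i. V (k + i)) [0..<n]"
    by (auto simp: subword_of_infinite_def)
  show ?thesis
  proof (rule that)
    fix i assume "i < n"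
    then show "x (int i) = V (k + i)"
      using arg_cong[OF k, of "\<lambda>u. u ! i"] by simp
  qed
qed

text \<open>A long stretch of each coordinate occurs in its infinite word at positions
  \<open>k\<close> and \<open>l\<close> that are unrelated, which is why the window lemma allows any
  such pair. The factor \<open>S + 1\<close> absorbs \<open>h + S\<close> into a multiple of
  \<open>h\<close>.\<close>

lemma return_windows_rank_one:
  assumes r: "cutting_parameter r" and s: "spacer_parameter r s" and t: "spacer_parameter r t"
    and sums: "\<And>n. (\<Sum>i<r n - 1. s n ! i) = (\<Sum>i<r n - 1. t n ! i)"
    and S: "\<And>n i. i < r n - 1 \<Longrightarrow> s n ! i \<le> S" "\<And>n i. i < r n - 1 \<Longrightarrow> t n ! i \<le> S"
    and n: "r n \<le> R" "incompatible (s n) (t n)"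
  shows "return_windows S ((2 * R + 2) * (S + 1))
    (word_shift_space (rank_one_word s) \<times> word_shift_space (rank_one_word t)) (length (gen_word s n))"
  unfolding return_windows_def
proof
  let ?C = "(2 * R + 2) * (S + 1)"
  define h where "h = length (gen_word s n)"
  have h: "0 < h"
    using length_gen_word[OF r s, of n] unfolding h_def
    by (metis less_le_trans zero_less_numeral zero_less_power)
  have ht: "length (gen_word t n) = h"
    using length_gen_word_eq[OF s t sums] by (simp add: h_def)
  have rn: "0 < r n" "length (s n) = r n - 1"
    using r s by (auto simp: cutting_parameter_def spacer_parameter_def intro: less_le_trans[of 0 2])
  fix z assume "z \<in> word_shift_space (rank_one_word s) \<times> word_shift_space (rank_one_word t)"
  then have z: "fst z \<in> word_shift_space (rank_one_word s)" "snd z \<in> word_shift_space (rank_one_word t)"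
    by auto
  define D where "D = ?C * h + 2 * h + S"
  obtain k where k: "\<And>i. i < D \<Longrightarrow> fst z (int i) = rank_one_word s (k + i)"
    using word_shift_space_window[OF z(1)] by blast
  obtain l where l: "\<And>i. i < D \<Longrightarrow> snd z (int i) = rank_one_word t (l + i)"
    using word_shift_space_window[OF z(2)] by blast
  obtain a where a: "\<And>i. a i \<le> S" "\<And>i. i mod r n < r n - 1 \<Longrightarrow> a i = s n ! (i mod r n)"
    "\<And>i j. j < h \<Longrightarrow> rank_one_word s ((\<Sum>i'<i. h + a i') + j) = gen_word s n ! j"
    using rank_one_word_spacers[OF r s S(1), of n] unfolding h_def by metis
  obtain b where b: "\<And>i. b i \<le> S" "\<And>i. i mod r n < r n - 1 \<Longrightarrow> b i = t n ! (i mod r n)"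
    "\<And>i j. j < h \<Longrightarrow> rank_one_word t ((\<Sum>i'<i. h + b i') + j) = gen_word t n ! j"
    using rank_one_word_spacers[OF r t S(2), of n] unfolding ht by metis
  have mismatch: "\<exists>i<r n. a (p + i) \<noteq> b (r n * q + i)" for p q
    using spacer_mismatch[OF n(2) rn, of a b p q] a(2) b(2) by (meson diff_le_self less_le_trans)
  obtain st \<alpha> \<beta> where ab: "\<alpha> \<le> S" "\<beta> \<le> S" "\<alpha> \<noteq> \<beta>" and st: "st \<le> (2 * r n + 2) * (h + S)"
    and rep: "\<And>\<tau>. st \<le> \<tau> \<Longrightarrow> \<tau> + S < st + h div 2 \<Longrightarrow>
      rank_one_word s (k + \<tau>) = rank_one_word s (k + \<tau> + h + \<alpha>) \<and>
      rank_one_word t (l + \<tau>) = rank_one_word t (l + \<tau> + h + \<beta>)"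
    using ex_window_with_distinct_return_times[where V = "rank_one_word s" and W = "rank_one_word t"
      and u = "\<lambda>j. gen_word s n ! j" and w = "\<lambda>j. gen_word t n ! j" and k = k and l = l,
      OF h rn(1) a(1) b(1) a(3) b(3) mismatch]
    by blast
  have "h + S \<le> (S + 1) * h"
    using h by (cases h) auto
  then have "(2 * r n + 2) * (h + S) \<le> (2 * R + 2) * ((S + 1) * h)"
    using n(1) by (intro mult_le_mono) auto
  with st have st': "st \<le> ?C * h"
    by (simp only: mult.assoc)
  have "fst z (int \<tau>) = fst z (int (\<tau> + h + \<alpha>)) \<and> snd z (int \<tau>) = snd z (int (\<tau> + h + \<beta>))"
    if \<tau>: "st \<le> \<tau>" "\<tau> + S < st + h div 2" for \<tau>
  proof -
    have "\<tau> < D" "\<tau> + h + \<alpha> < D" "\<tau> + h + \<beta> < D"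
      using \<tau> st' ab by (auto simp: D_def)
    then show ?thesis
      using rep[OF \<tau>] k[of \<tau>] k[of "\<tau> + h + \<alpha>"] l[of \<tau>] l[of "\<tau> + h + \<beta>"]
      by (simp add: add.assoc)
  qed
  with ab st' show "\<exists>st \<alpha> \<beta>. \<alpha> \<le> S \<and> \<beta> \<le> S \<and> \<alpha> \<noteq> \<beta> \<and> st \<le> ?C * length (gen_word s n) \<and>
     (\<forall>\<tau>. st \<le> \<tau> \<longrightarrow> \<tau> + S < st + length (gen_word s n) div 2 \<longrightarrow>
        fst z (int \<tau>) = fst z (int (\<tau> + length (gen_word s n) + \<alpha>)) \<and>
        snd z (int \<tau>) = snd z (int (\<tau> + length (gen_word s n) + \<beta>)))"
    unfolding h_def by blast
qed

text \<open>The averaging result reads nonnegative coordinates and compares relative shifts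
  \<open>S\<close> and \<open>S + K\<close>. Translating the pair by \<open>S + m\<close> meets both
  demands: \<open>m\<close> makes the coordinates nonnegative, and the extra \<open>S\<close> in
  \<open>A'\<close> cancels the initial relative shift.\<close>

lemma joining_relative_shift_invariant:
  fixes M N :: "(int \<Rightarrow> nat) measure"
  assumes L: "L \<in> joinings M shift_map N shift_map" "prob_space L"
    and M: "sets M = sets (restrict_space borel X)" and N: "sets N = sets (restrict_space borel Y)"
    and windows: "\<And>h0. \<exists>h\<ge>h0. return_windows S C (X \<times> Y) h"
    and K: "0 < K" "\<And>d. 0 < d \<Longrightarrow> d \<le> S \<Longrightarrow> d dvd K"
    and A: "finitely_determined A" and B: "finitely_determined B"
  shows "measure L ((A \<inter> X) \<times> ((shift_map ^^ K) -` B \<inter> Y)) = measure L ((A \<inter> X) \<times> (B \<inter> Y))"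
proof -
  let ?T = "map_prod shift_map shift_map"
  have sets: "sets L = sets (M \<Otimes>\<^sub>M N)" and T: "preserves_measure L ?T"
    using L(1) by (auto simp: joinings_def)
  have "space M = X" "space N = Y"
    using sets_eq_imp_space_eq[OF M] sets_eq_imp_space_eq[OF N]
    by (simp_all add: space_restrict_space)
  then have space: "space L = X \<times> Y"
    using sets_eq_imp_space_eq[OF sets] by (simp add: space_pair_measure)
  have meas: "(C \<inter> X) \<times> (D \<inter> Y) \<in> sets L" if "finitely_determined C" "finitely_determined D" for C D
  proof -
    have "C \<inter> X \<in> sets M" "D \<inter> Y \<in> sets N"
      unfolding M N by (intro sets_restrict_space_finitely_determined that)+
    then show ?thesis
      by (simp add: sets)
  qed
  obtain m1 :: nat where m1: "\<And>x y. (\<forall>i. \<bar>i\<bar> \<le> int m1 \<longrightarrow> x i = y i) \<Longrightarrow> (x \<in> A \<longleftrightarrow> y \<in> A)"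
    using A unfolding finitely_determined_def by metis
  obtain m2 :: nat where m2: "\<And>x y. (\<forall>i. \<bar>i\<bar> \<le> int m2 \<longrightarrow> x i = y i) \<Longrightarrow> (x \<in> B \<longleftrightarrow> y \<in> B)"
    using B unfolding finitely_determined_def by metis
  define m where "m = m1 + m2"
  define A' where "A' = (shift_map ^^ (S + m)) -` A"
  define B' where "B' = (shift_map ^^ m) -` B"
  have shift: "measure L ((A \<inter> X) \<times> ((shift_map ^^ e) -` B \<inter> Y)) =
      measure L {z \<in> space L. fst z \<in> A' \<and> (shift_map ^^ (S + e)) (snd z) \<in> B'}" for e
  proof -
    have T': "?T ^^ (S + m) \<in> measurable L L"
      using preserves_measure_funpow[OF T] by (simp add: preserves_measure_def)
    let ?E = "(A \<inter> X) \<times> ((shift_map ^^ e) -` B \<inter> Y)"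
    have "emeasure L ?E = emeasure L ((?T ^^ (S + m)) -` ?E \<inter> space L)"
      by (rule emeasure_preserves_measure[OF preserves_measure_funpow[OF T], symmetric])
         (intro meas A finitely_determined_shift B)
    moreover have "(?T ^^ (S + m)) -` ?E \<inter> space L =
        {z \<in> space L. fst z \<in> A' \<and> (shift_map ^^ (S + e)) (snd z) \<in> B'}"
    proof -
      have "(shift_map ^^ e) ((shift_map ^^ (S + m)) y) = (shift_map ^^ m) ((shift_map ^^ (S + e)) y)" for y :: "int \<Rightarrow> nat"
        by (rule ext) (simp add: shift_map_funpow algebra_simps)
      moreover have "(shift_map ^^ (S + m)) (fst z) \<in> X" "(shift_map ^^ (S + m)) (snd z) \<in> Y"
        if "z \<in> space L" for z
        using measurable_space[OF T' that] by (simp_all add: space map_prod_funpow)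
      ultimately show ?thesis
        by (auto simp: A'_def B'_def map_prod_funpow)
    qed
    ultimately show ?thesis
      by (simp add: measure_def)
  qed
  have "measure L {z \<in> space L. fst z \<in> A' \<and> (shift_map ^^ S) (snd z) \<in> B'} =
    measure L {z \<in> space L. fst z \<in> A' \<and> (shift_map ^^ (S + K)) (snd z) \<in> B'}"
  proof (rule measure_relative_shift_eq[OF L(2) T, where m = "S + 2 * m + 1"])
    show "x \<in> A' \<longleftrightarrow> y \<in> A'" if eq: "\<And>c. c < S + 2 * m + 1 \<Longrightarrow> x (int c) = y (int c)" for x y :: "int \<Rightarrow> nat"
      unfolding A'_def vimage_eq
    proof (rule m1, intro allI impI)
      fix i assume i: "\<bar>i\<bar> \<le> int m1"
      define c where "c = nat (i + int (S + m))"
      have c: "int c = i + int (S + m)"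
        using i by (simp add: c_def m_def)
      have "int c < int (S + 2 * m + 1)"
        unfolding c using i by (simp add: m_def)
      then have "c < S + 2 * m + 1"
        by (simp only: of_nat_less_iff)
      then show "(shift_map ^^ (S + m)) x i = (shift_map ^^ (S + m)) y i"
        using eq[of c] unfolding shift_map_funpow c by simp
    qed
    show "x \<in> B' \<longleftrightarrow> y \<in> B'" if eq: "\<And>c. c < S + 2 * m + 1 \<Longrightarrow> x (int c) = y (int c)" for x y :: "int \<Rightarrow> nat"
      unfolding B'_def vimage_eq
    proof (rule m2, intro allI impI)
      fix i assume i: "\<bar>i\<bar> \<le> int m2"
      define c where "c = nat (i + int m)"
      have c: "int c = i + int m"
        using i by (simp add: c_def m_def)
      have "int c < int (S + 2 * m + 1)"
        unfolding c using i by (simp add: m_def)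
      then have "c < S + 2 * m + 1"
        by (simp only: of_nat_less_iff)
      then show "(shift_map ^^ m) x i = (shift_map ^^ m) y i"
        using eq[of c] unfolding shift_map_funpow c by simp
    qed
    show "{z \<in> space L. fst z \<in> A' \<and> (shift_map ^^ e) (snd z) \<in> B'} \<in> sets L" for e
    proof -
      have "{z \<in> space L. fst z \<in> A' \<and> (shift_map ^^ e) (snd z) \<in> B'} =
          (A' \<inter> X) \<times> ((shift_map ^^ e) -` B' \<inter> Y)"
        by (auto simp: space)
      then show ?thesis
        unfolding A'_def B'_def by (simp only:) (intro meas finitely_determined_shift A B)
    qed
  qed (use windows K in \<open>simp_all add: space\<close>)
  then show ?thesis
    using shift[of 0] shift[of K] by simp
qed

theorem theorem3p2:
  fixes r :: "nat \<Rightarrow> nat" and s t :: "nat \<Rightarrow> nat list"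
    and \<mu> \<nu> :: "(int \<Rightarrow> nat) measure"
  assumes "symbolic_rank_one_system r s \<mu>"
    and "symbolic_rank_one_system r t \<nu>"
    and "\<forall>n. (\<Sum>i<r n - 1. s n ! i) = (\<Sum>i<r n - 1. t n ! i)"
    and "\<exists>S. \<forall>n. \<forall>i<r n - 1. s n ! i \<le> S \<and> t n ! i \<le> S"
    and "\<exists>R. infinite {n. r n \<le> R \<and> incompatible (s n) (t n)}"
    and "\<forall>k::nat. k > 1 \<longrightarrow> ergodic \<mu> (shift_map ^^ k) \<or> ergodic \<nu> (shift_map ^^ k)"
  shows "disjoint_systems \<mu> shift_map \<nu> shift_map"
proof -
  define X where "X = word_shift_space (rank_one_word s)"
  define Y where "Y = word_shift_space (rank_one_word t)"
  have params: "cutting_parameter r" "spacer_parameter r s" "spacer_parameter r t"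
    and "\<mu> \<in> invariant_probabilities X" "\<nu> \<in> invariant_probabilities Y"
    using assms(1,2) by (auto simp: symbolic_rank_one_system_def X_def Y_def)
  then have M: "sets \<mu> = sets (restrict_space borel X)" "prob_space \<mu>" "preserves_measure \<mu> shift_map"
    and N: "sets \<nu> = sets (restrict_space borel Y)" "prob_space \<nu>" "preserves_measure \<nu> shift_map"
    by (simp_all add: invariant_probabilities_def)
  interpret \<mu>: prob_space \<mu> by fact
  interpret \<nu>: prob_space \<nu> by fact
  interpret \<mu>\<nu>: pair_prob_space \<mu> \<nu> ..
  have space: "space \<mu> = X" "space \<nu> = Y"
    using sets_eq_imp_space_eq[OF M(1)] sets_eq_imp_space_eq[OF N(1)]
    by (simp_all add: space_restrict_space)
  obtain S where S: "\<And>n i. i < r n - 1 \<Longrightarrow> s n ! i \<le> S" "\<And>n i. i < r n - 1 \<Longrightarrow> t n ! i \<le> S"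
    using assms(4) by blast
  obtain R where R: "infinite {n. r n \<le> R \<and> incompatible (s n) (t n)}"
    using assms(5) by blast
  define C where "C = (2 * R + 2) * (S + 1)"
  have windows: "\<exists>h\<ge>h0. return_windows S C (X \<times> Y) h" for h0
  proof -
    obtain n where n: "h0 \<le> n" "r n \<le> R" "incompatible (s n) (t n)"
      using R unfolding infinite_nat_iff_unbounded_le by blast
    have "h0 \<le> length (gen_word s n)"
      using length_gen_word[OF params(1,2), of n] less_exp[of n] n(1) by linarith
    moreover have "return_windows S C (X \<times> Y) (length (gen_word s n))"
      unfolding X_def Y_def C_def
      by (rule return_windows_rank_one[OF params assms(3)[rule_format] S n(2,3)])
    ultimately show ?thesis
      by blast
  qed
  \<comment> \<open>The factorial is a multiple of every positive difference up to \<open>S\<close>;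
    the added 2 ensures \<open>1 < K\<close>, as the ergodicity hypothesis requires.\<close>
  define K :: nat where "K = fact (S + 2)"
  have "S + 2 \<le> K"
    unfolding K_def by (rule fact_ge_self)
  then have K: "1 < K" "\<And>d. 0 < d \<Longrightarrow> d \<le> S \<Longrightarrow> d dvd K"
    unfolding K_def by (linarith, intro dvd_fact) simp_all
  have product: "L = \<mu> \<Otimes>\<^sub>M \<nu>" if L: "L \<in> joinings \<mu> shift_map \<nu> shift_map" for L
  proof -
    have sets: "sets L = sets (\<mu> \<Otimes>\<^sub>M \<nu>)" and T: "preserves_measure L (map_prod shift_map shift_map)"
      and marg: "distr L \<mu> fst = \<mu>" "distr L \<nu> snd = \<nu>"
      using L by (auto simp: joinings_def)
    have spaceL: "space L = X \<times> Y"
      using sets_eq_imp_space_eq[OF sets] by (simp add: space_pair_measure space)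
    have "emeasure L (space L) = 1"
      using emeasure_joining_marginals(1)[OF sets marg sets.top] \<mu>.emeasure_space_1
      by (simp add: spaceL space)
    then interpret L: prob_space L
      by (rule prob_spaceI)
    have inv: "emeasure L ((A \<inter> X) \<times> ((shift_map ^^ K) -` B \<inter> Y)) = emeasure L ((A \<inter> X) \<times> (B \<inter> Y))"
      if "finitely_determined A" "finitely_determined B" for A B
      using joining_relative_shift_invariant[OF L L.prob_space_axioms M(1) N(1) windows _ K(2) that] K(1)
      by (simp add: L.emeasure_eq_measure)
    have stable: "(shift_map ^^ K) x \<in> space P" if "preserves_measure P shift_map" "x \<in> space P"
      for x and P :: "(int \<Rightarrow> nat) measure"
      using preserves_measure_funpow[OF that(1)] that(2)
      by (auto simp: preserves_measure_def dest: measurable_space)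
    have preim: "(shift_map ^^ K) -` (B \<inter> space P) \<inter> space P = (shift_map ^^ K) -` B \<inter> space P"
      if "preserves_measure P shift_map" for B and P :: "(int \<Rightarrow> nat) measure"
      using stable[OF that] by auto
    have mult: "emeasure L (A \<times> B) = emeasure \<mu> A * emeasure \<nu> B" if AB: "A \<in> sets \<mu>" "B \<in> sets \<nu>" for A B
    proof (cases "ergodic \<nu> (shift_map ^^ K)")
      case True
      show ?thesis
      proof (rule emeasure_joining_eq_mult[OF sets marg M(1,2) N(1) True _ AB])
        fix A B :: "(int \<Rightarrow> nat) set" assume "finitely_determined A" "finitely_determined B"
        then show "emeasure L ((A \<inter> X) \<times> ((shift_map ^^ K) -` (B \<inter> Y) \<inter> Y)) = emeasure L ((A \<inter> X) \<times> (B \<inter> Y))"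
          using inv[of A B] preim[OF N(3), of B] by (simp add: space)
      qed
    next
      case False
      then have erg: "ergodic \<mu> (shift_map ^^ K)"
        using assms(6) K(1) by blast
      \<comment> \<open>The product formula expects the ergodic factor in the second coordinate, so
        the coordinates are exchanged.\<close>
      define L' where "L' = distr L (\<nu> \<Otimes>\<^sub>M \<mu>) prod.swap"
      have swap: "prod.swap \<in> measurable L (\<nu> \<Otimes>\<^sub>M \<mu>)"
        unfolding prod.swap_def by (simp add: measurable_cong_sets[OF sets refl])
      have L': "emeasure L' (B \<times> A) = emeasure L (A \<times> B)" if "A \<in> sets \<mu>" "B \<in> sets \<nu>" for A B
      proof -
        have "prod.swap -` (B \<times> A) \<inter> space L = A \<times> B"
          using sets.sets_into_space[OF that(1)] sets.sets_into_space[OF that(2)]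
          by (auto simp: spaceL space)
        then show ?thesis
          using that by (simp add: L'_def emeasure_distr[OF swap])
      qed
      have sets': "sets L' = sets (\<nu> \<Otimes>\<^sub>M \<mu>)"
        by (simp add: L'_def)
      have marg': "distr L' \<nu> fst = \<nu>" "distr L' \<mu> snd = \<mu>"
        using marg swap by (simp_all add: L'_def distr_distr comp_def)
      have "emeasure L' (B \<times> A) = emeasure \<nu> B * emeasure \<mu> A"
      proof (rule emeasure_joining_eq_mult[OF sets' marg' N(1,2) M(1) erg _ AB(2,1)])
        fix B A :: "(int \<Rightarrow> nat) set" assume fd: "finitely_determined B" "finitely_determined A"
        have meas: "B \<inter> X \<in> sets \<mu>" "B \<inter> Y \<in> sets \<nu>" if "finitely_determined B" for B
          unfolding M(1) N(1) by (intro sets_restrict_space_finitely_determined that)+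
        let ?A = "(shift_map ^^ K) -` A" and ?B = "(shift_map ^^ K) -` B"
        note fd' = fd[THEN finitely_determined_shift, of K]
        \<comment> \<open>Relative invariance, read backwards, inserts the shift into the second
          coordinate as well; invariance of \<open>L\<close> under the joint shift then removes it
          from both.\<close>
        have "emeasure L ((?A \<inter> X) \<times> (B \<inter> Y)) = emeasure L ((?A \<inter> X) \<times> (?B \<inter> Y))"
          by (rule inv[OF fd'(2) fd(1), symmetric])
        also have "(?A \<inter> X) \<times> (?B \<inter> Y) = (map_prod shift_map shift_map ^^ K) -` ((A \<inter> X) \<times> (B \<inter> Y)) \<inter> space L"
          using stable[OF M(3)] stable[OF N(3)] by (auto simp: map_prod_funpow spaceL space)
        also have "emeasure L \<dots> = emeasure L ((A \<inter> X) \<times> (B \<inter> Y))"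
          using meas(1)[OF fd(2)] meas(2)[OF fd(1)]
          by (intro emeasure_preserves_measure preserves_measure_funpow T) (simp add: sets)
        finally show "emeasure L' ((B \<inter> Y) \<times> ((shift_map ^^ K) -` (A \<inter> X) \<inter> X)) = emeasure L' ((B \<inter> Y) \<times> (A \<inter> X))"
          using preim[OF M(3), of A] meas fd fd' by (simp add: L' space)
      qed
      then show ?thesis
        using L'[OF AB] by (simp add: mult.commute)
    qed
    show ?thesis
      by (rule pair_measure_eqI[symmetric])
         (use mult in \<open>auto simp: sets intro: \<mu>.sigma_finite_measure_axioms \<nu>.sigma_finite_measure_axioms\<close>)
  qed
  moreover have "\<mu> \<Otimes>\<^sub>M \<nu> \<in> joinings \<mu> shift_map \<nu> shift_map"
  proof -
    have sh: "shift_map \<in> measurable \<mu> \<mu>" "shift_map \<in> measurable \<nu> \<nu>"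
      "distr \<mu> \<mu> shift_map = \<mu>" "distr \<nu> \<nu> shift_map = \<nu>"
      using M(3) N(3) by (simp_all add: preserves_measure_def)
    have "distr \<mu> \<mu> shift_map \<Otimes>\<^sub>M distr \<nu> \<nu> shift_map =
        distr (\<mu> \<Otimes>\<^sub>M \<nu>) (\<mu> \<Otimes>\<^sub>M \<nu>) (\<lambda>(x, y). (shift_map x, shift_map y))"
      by (rule pair_measure_distr) (use sh \<nu>.sigma_finite_measure_axioms in simp_all)
    then have "preserves_measure (\<mu> \<Otimes>\<^sub>M \<nu>) (map_prod shift_map shift_map)"
      using sh by (simp add: preserves_measure_def map_prod_def case_prod_beta)
    moreover have "distr (\<mu> \<Otimes>\<^sub>M \<nu>) \<mu> fst = \<mu>"
      by (rule \<nu>.distr_pair_fst)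
    moreover have "distr (\<mu> \<Otimes>\<^sub>M \<nu>) \<nu> snd = \<nu>"
    proof (rule measure_eqI)
      fix B assume "B \<in> sets (distr (\<mu> \<Otimes>\<^sub>M \<nu>) \<nu> snd)"
      then have B: "B \<in> sets \<nu>"
        by simp
      then have "snd -` B \<inter> space (\<mu> \<Otimes>\<^sub>M \<nu>) = space \<mu> \<times> B"
        using sets.sets_into_space[OF B] by (auto simp: space_pair_measure)
      then show "emeasure (distr (\<mu> \<Otimes>\<^sub>M \<nu>) \<nu> snd) B = emeasure \<nu> B"
        using B by (simp add: emeasure_distr \<nu>.emeasure_pair_measure_Times \<mu>.emeasure_space_1)
    qed simp
    ultimately show ?thesis
      by (simp add: joinings_def)
  qed
  ultimately show ?thesis
    unfolding disjoint_systems_def by blast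
qed

end
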